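(* Let $U$ and $C$ be real-valued random variables, $A\in\{0,1\}$ a binary random variable, $Y(1),Y(0)$ real-valued potential outcomes, and $Y$ the observed outcome. Assume: (1) (Causal assumptions) (i) $Y = Y(1)A + Y(0)(1-A)$; (ii) for some $\epsilon>0$, $\epsilon \le P(A=1\mid U=u)\le 1-\epsilon$ for all $u$; (iii) $\{Y(1),Y(0)\}$ is independent of $A$ conditionally on $U$. (2) (Monotonicity) (i) $E(Y\mid A=a,U=u)$ is non-decreasing in $u$ for $a=0,1$; (ii) $P(A=1\mid U=u)$ is non-decreasing in $u$. (3) (Nondifferential mismeasurement) $C$ is independent of $(A,Y)$ conditionally on $U$. (4) At least one of the following holds: (a) (positive regression dependence) $U$ is positively regression dependent on $C$, and for each $a\in\{0,1\}$, $U$ is positively regression dependent on $C$ given $A=a$; or (b) (positive likelihood ratio dependence) $C$ has positive likelihood ratio dependence on $U$. For $a=0,1$ let $\mu_a^{\mathrm{unadj}} = E(Y\mid A=a)$ and $\mu_a^{\mathrm{adj}} = \int E(Y\mid A=a,C=c) f(c)\,dc$. Then for any non-decreasing real functions $h,g$ (defined at the relevant arguments), $$h\big[g\{\mu_1^{\mathrm{unadj}}\}-g\{\mu_0^{\mathrm{unadj}}\}\big]\ \ge\ h\big[g\{\mu_1^{\mathrm{adj}}\}-g\{\mu_0^{\mathrm{adj}}\}\big]\ \ge\ h\big[g\{E[Y(1)]\}-g\{E[Y(0)]\}\big].$$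
   Context: $f$ denotes a density or probability mass function (conditional when a bar appears); $\int(\cdot)f(c)\,dc$ is the expectation under the marginal law of $C$ (a sum if $C$ is discrete). Statements "for all $u$" or "in $c$" refer to values in the support of the corresponding variable, for suitable versions of conditional distributions. All expectations appearing are assumed to exist and be finite. Positive regression dependence: $U$ is positively regression dependent on $C$ if $P(U\ge u\mid C=c)$ is non-decreasing in $c$ for every $u$ in the support of $U$; it is positively regression dependent on $C$ given $A=a$ if $P(U\ge u\mid C=c,A=a)$ is non-decreasing in $c$ for every $u$ in the support of $U$. Positive likelihood ratio dependence: $C$ has positive likelihood ratio dependence on $U$ if $f(c'\mid u')f(c\mid u)\ge f(c\mid u')f(c'\mid u)$ for all $c'>c$ in the support of $C$ and $u'>u$ in the support of $U$, where $f(\cdot\mid u)$ is the conditional density or mass function of $C$ given $U=u$. *)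

theory Defs
  imports "HOL-Probability.Probability"
begin

text \<open>
  The probability measure \<open>P(\<sqdot> | A = a)\<close>. Expressions conditional on \<open>A = a\<close>, possibly together
  with \<open>U = u\<close> or \<open>C = c\<close>, are formed under this measure.
\<close>

definition given :: "'w measure \<Rightarrow> ('w \<Rightarrow> real) \<Rightarrow> real \<Rightarrow> 'w measure" where
  "given M A a = uniform_measure M {\<omega> \<in> space M. A \<omega> = a}"

text \<open>
  Conditional expectations and distributions are determined only up to null sets of the conditioning
  variable, so pointwise conditions on them need not hold at every point of the topological support
  (for a discrete variable whose atoms accumulate, the limit points are not values it takes).
  A support is therefore any Borel set carrying the variable with probability one: the set
  of atoms of a discrete variable, the set where a density is positive, and the topological support
  all qualify.
\<close>

definition is_support :: "'w measure \<Rightarrow> ('w \<Rightarrow> real) \<Rightarrow> real set \<Rightarrow> bool" where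
  "is_support M X S \<longleftrightarrow> S \<in> sets borel \<and> (AE \<omega> in M. X \<omega> \<in> S)"

definition sigma_gen :: "'w measure \<Rightarrow> ('w \<Rightarrow> real) \<Rightarrow> 'w measure" where
  "sigma_gen M X = vimage_algebra (space M) X borel"

text \<open>\<open>m\<close> is a version of \<open>x \<mapsto> E(Y | X = x)\<close>.\<close>

definition is_cond_exp ::
    "'w measure \<Rightarrow> ('w \<Rightarrow> real) \<Rightarrow> ('w \<Rightarrow> real) \<Rightarrow> (real \<Rightarrow> real) \<Rightarrow> bool" where
  "is_cond_exp M Y X m \<longleftrightarrow>
     m \<in> borel_measurable borel \<and>
     (AE \<omega> in M. m (X \<omega>) = real_cond_exp M (sigma_gen M X) Y \<omega>)"

text \<open>\<open>\<kappa>\<close> is a (regular) version of the conditional distribution of \<open>Z\<close> given \<open>X\<close>.\<close>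

definition is_cond_distr ::
    "'w measure \<Rightarrow> ('w \<Rightarrow> real) \<Rightarrow> ('w \<Rightarrow> real) \<Rightarrow> (real \<Rightarrow> real measure) \<Rightarrow> bool" where
  "is_cond_distr M Z X \<kappa> \<longleftrightarrow>
     \<kappa> \<in> borel \<rightarrow>\<^sub>M prob_algebra borel \<and>
     (\<forall>B \<in> sets borel. \<forall>D \<in> sets borel.
        emeasure M {\<omega> \<in> space M. Z \<omega> \<in> B \<and> X \<omega> \<in> D} =
        (\<integral>\<^sup>+x\<in>D. emeasure (\<kappa> x) B \<partial>distr M borel X))"

text \<open>\<open>X\<close> and \<open>Z\<close> are conditionally independent given \<open>V\<close>.\<close>

definition cond_indep ::
    "'w measure \<Rightarrow> ('w \<Rightarrow> 'b::topological_space) \<Rightarrow> ('w \<Rightarrow> 'c::topological_space) \<Rightarrow>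
     ('w \<Rightarrow> real) \<Rightarrow> bool" where
  "cond_indep M X Z V \<longleftrightarrow>
     (\<forall>B \<in> sets borel. \<forall>D \<in> sets borel. AE \<omega> in M.
        real_cond_exp M (sigma_gen M V) (\<lambda>\<omega>. indicator B (X \<omega>) * indicator D (Z \<omega>)) \<omega> =
        real_cond_exp M (sigma_gen M V) (\<lambda>\<omega>. indicator B (X \<omega>)) \<omega> *
        real_cond_exp M (sigma_gen M V) (\<lambda>\<omega>. indicator D (Z \<omega>)) \<omega>)"

text \<open>
  \<open>U\<close> is positively regression dependent on \<open>C\<close>; \<open>SU\<close> and \<open>SC\<close> are the supports of \<open>U\<close> and \<open>C\<close>.
\<close>

definition pos_regression_dep ::
    "'w measure \<Rightarrow> real set \<Rightarrow> real set \<Rightarrow> ('w \<Rightarrow> real) \<Rightarrow> ('w \<Rightarrow> real) \<Rightarrow> bool" where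
  "pos_regression_dep M SU SC U C \<longleftrightarrow>
     (\<exists>\<kappa>. is_cond_distr M U C \<kappa> \<and>
          (\<forall>u \<in> SU. mono_on SC (\<lambda>c. measure (\<kappa> c) {u..})))"

text \<open>
  \<open>f u c\<close> is the conditional density, or else the conditional probability mass function, \<open>f(c | u)\<close>
  of \<open>C\<close> given \<open>U = u\<close>. The alternative is the same for all \<open>u\<close>: values of a density and of a mass
  function are not comparable.
\<close>

definition is_cond_density ::
    "'w measure \<Rightarrow> real set \<Rightarrow> ('w \<Rightarrow> real) \<Rightarrow> ('w \<Rightarrow> real) \<Rightarrow> (real \<Rightarrow> real \<Rightarrow> real) \<Rightarrow> bool" where
  "is_cond_density M SU C U f \<longleftrightarrow>
     (\<exists>\<kappa>. is_cond_distr M C U \<kappa> \<and>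
        (((\<lambda>(u, c). f u c) \<in> borel_measurable borel \<and>
          (\<forall>u \<in> SU. (\<forall>c. 0 \<le> f u c) \<and> \<kappa> u = density lborel (\<lambda>c. ennreal (f u c)))) \<or>
         (\<exists>D. countable D \<and>
          (\<forall>u \<in> SU. measure (\<kappa> u) D = 1 \<and> (\<forall>c. f u c = measure (\<kappa> u) {c})))))"

text \<open>\<open>C\<close> has positive likelihood ratio dependence on \<open>U\<close>.\<close>

definition pos_likelihood_ratio_dep ::
    "'w measure \<Rightarrow> real set \<Rightarrow> real set \<Rightarrow> ('w \<Rightarrow> real) \<Rightarrow> ('w \<Rightarrow> real) \<Rightarrow> bool" where
  "pos_likelihood_ratio_dep M SU SC C U \<longleftrightarrow>
     (\<exists>f. is_cond_density M SU C U f \<and>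
          (\<forall>c \<in> SC. \<forall>c' \<in> SC. \<forall>u \<in> SU. \<forall>u' \<in> SU. c' > c \<longrightarrow> u' > u \<longrightarrow>
             f u' c' * f u c \<ge> f u' c * f u c'))"

definition mean_unadj :: "'w measure \<Rightarrow> ('w \<Rightarrow> real) \<Rightarrow> ('w \<Rightarrow> real) \<Rightarrow> real \<Rightarrow> real" where
  "mean_unadj M A Y a = (\<integral>\<omega>. Y \<omega> \<partial>given M A a)"

text \<open>
  Here \<open>r c\<close> stands for \<open>E(Y | A = a, C = c)\<close>; it is integrated against the law of \<open>C\<close> under \<open>M\<close>,
  not under \<open>given M A a\<close>.
\<close>

definition mean_adj :: "'w measure \<Rightarrow> ('w \<Rightarrow> real) \<Rightarrow> (real \<Rightarrow> real) \<Rightarrow> real" where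
  "mean_adj M C r = (\<integral>c. r c \<partial>distr M borel C)"

end

theory Submission
  imports Defs
begin

text \<open>
  Write \<open>w(u) = P(A = a | U = u)\<close>, \<open>m(u) = E(Y | A = a, U = u)\<close>, \<open>q = P(A = a)\<close> and \<open>\<rho> = E(w(U) | C)\<close>.
  By conditional independence the unadjusted mean is \<open>E(m(U) | A = a)\<close>, the adjusted mean is both
  \<open>E(m(U) w(U) / \<rho>)\<close> and \<open>E(m(U) q / \<rho> | A = a)\<close>, and \<open>E(Y(a)) = E(m(U))\<close>. For \<open>a = 1\<close> the
  difference of the last two means is \<open>E(m(U) (w(U) - \<rho>) / \<rho>) \<ge> 0\<close>, by Chebyshev's association
  inequality conditionally on \<open>C\<close>. The difference of the first two is \<open>E(m(U) (1 - q / \<rho>) | A = a)\<close>,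
  where \<open>1 - q / \<rho>\<close> has mean zero given \<open>A = a\<close> and is increasing in \<open>C\<close>, as is \<open>E(m(U) | A = a, C)\<close>;
  so Chebyshev's inequality applies again. Only this second step uses the dependence of \<open>U\<close> and \<open>C\<close>:
  either assumption makes conditional expectations given \<open>C\<close> of monotone functions of \<open>U\<close> monotone in
  \<open>C\<close>. For \<open>a = 0\<close> all the inequalities are reversed, because \<open>w\<close> is then non-increasing.
\<close>

section \<open>Single crossing and stochastic dominance\<close>

text \<open>Every association inequality here rests on one device: a weight of mean zero that
  changes sign only once, from negative to positive, is multiplied by an increasing function minus a
  level separating the values of that function on the two sides of the sign change. The product is
  pointwise nonnegative and the level integrates away. The same device shows that likelihood ratio
  dependence makes posterior means increase. The obstacle is that monotonicity is known only on a
  support and conditional expectations only almost everywhere. A monotone function of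
  \<open>C\<close> therefore always comes with a set that carries \<open>C\<close>, and this set may
  depend on the function being averaged. Separating levels need bounds, whereas \<open>m\<close> may
  be unbounded, so truncation precedes them. The adjusted mean is written in two ways because its
  two comparisons live under different measures: \<open>M\<close> for the causal mean, the
  conditional measure of the arm for the unadjusted one. Likelihood ratio dependence is assumed
  under \<open>M\<close> only; it passes to the arms because \<open>A\<close> carries no information
  on \<open>C\<close> once \<open>U\<close> is known.\<close>

definition threshold :: "(real \<Rightarrow> real) \<Rightarrow> real \<Rightarrow> real set \<Rightarrow> real" where
  "threshold m B T = Sup (insert (- B) (m ` T))"

text \<open>The inserted value \<open>- B\<close> acts as a floor: it gives the empty set a
  threshold, keeps the threshold within the bound of \<open>m\<close>, and preserves monotonicity in
  the set.\<close>

lemma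
  assumes "\<And>u. u \<in> T \<Longrightarrow> \<bar>m u\<bar> \<le> B" "0 \<le> B"
  shows threshold_upper: "u \<in> T \<Longrightarrow> m u \<le> threshold m B T"
    and threshold_abs: "\<bar>threshold m B T\<bar> \<le> B"
    and threshold_least: "- B \<le> x \<Longrightarrow> (\<And>u. u \<in> T \<Longrightarrow> m u \<le> x) \<Longrightarrow> threshold m B T \<le> x"
proof -
  have bdd: "bdd_above (insert (- B) (m ` T))"
    by (rule bdd_aboveI[of _ B]) (use assms in \<open>force simp: abs_le_iff\<close>)
  show "u \<in> T \<Longrightarrow> m u \<le> threshold m B T"
    unfolding threshold_def by (intro cSup_upper bdd) auto
  show le: "- B \<le> x \<Longrightarrow> (\<And>u. u \<in> T \<Longrightarrow> m u \<le> x) \<Longrightarrow> threshold m B T \<le> x" for x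
    unfolding threshold_def by (intro cSup_least) auto
  have "- B \<le> threshold m B T"
    unfolding threshold_def by (intro cSup_upper bdd) auto
  moreover have "threshold m B T \<le> B"
    by (rule le) (use assms in \<open>auto simp: abs_le_iff\<close>)
  ultimately show "\<bar>threshold m B T\<bar> \<le> B" by auto
qed

text \<open>The crossing condition puts every point with \<open>d < 0\<close> weakly to the left of
  every point with \<open>d > 0\<close>. Hence the supremum of \<open>m\<close> over the former is
  at most each value of \<open>m\<close> on the latter, and both factors always have compatible
  signs.\<close>

lemma single_crossing_threshold:
  assumes m: "mono_on S m" "\<And>u. u \<in> S \<Longrightarrow> \<bar>m u\<bar> \<le> B" "0 \<le> B"
    and cross: "\<And>u v. u \<in> S \<Longrightarrow> v \<in> S \<Longrightarrow> u < v \<Longrightarrow> 0 < d u \<Longrightarrow> 0 \<le> d v"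
    and u: "u \<in> S"
  shows "0 \<le> d u * (m u - threshold m B {u \<in> S. d u < 0})"
proof -
  let ?T = "{u \<in> S. d u < 0}"
  have B: "\<And>u. u \<in> ?T \<Longrightarrow> \<bar>m u\<bar> \<le> B" using m by auto
  consider "d u < 0" | "d u = 0" | "0 < d u" by linarith
  then show ?thesis
  proof cases
    case 1
    then have "m u \<le> threshold m B ?T" using u by (intro threshold_upper B m(3)) auto
    with 1 show ?thesis by (simp add: mult_nonpos_nonpos)
  next
    case 3
    have "threshold m B ?T \<le> m u"
    proof (rule threshold_least[OF B m(3)])
      show "- B \<le> m u" using m(2)[OF u] by linarith
      fix v assume v: "v \<in> ?T"
      then have "v \<le> u" using cross[OF u, of v] 3 by (auto simp: not_less[symmetric])
      with v u m(1) show "m v \<le> m u" by (auto simp: mono_on_def)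
    qed auto
    with 3 show ?thesis by simp
  qed simp
qed

text \<open>This makes a threshold that depends on a real parameter monotone in it, and so
  measurable.\<close>

lemma mono_threshold:
  assumes "\<And>u. u \<in> S \<Longrightarrow> \<bar>m u\<bar> \<le> B" "0 \<le> B" "T \<subseteq> T'" "T' \<subseteq> S"
  shows "threshold m B T \<le> threshold m B T'"
proof (rule threshold_least)
  have B: "\<And>u. u \<in> T' \<Longrightarrow> \<bar>m u\<bar> \<le> B" using assms by auto
  show "- B \<le> threshold m B T'" using threshold_abs[of T' m B, OF B assms(2)] by auto
  show "m u \<le> threshold m B T'" if "u \<in> T" for u
    using that assms(3) by (intro threshold_upper[of T' m B, OF B assms(2)]) auto
qed (use assms in auto)

section \<open>Stochastic order from tails at points of a support\<close>

text \<open>Tails are comparable only at points of \<open>S\<close>, and \<open>Inf D\<close> may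
  lie outside \<open>S\<close>. If the infimum is attained, \<open>D\<close> lies in a comparable
  ray; otherwise rays starting at points of \<open>D\<close> exhaust \<open>D\<close> up to small
  \<open>P\<close>-mass. In both cases \<open>Q\<close> gives such a ray at most the mass of
  \<open>D\<close>, since almost all its points lie in \<open>S\<close> and thus in
  \<open>D\<close>.\<close>

lemma measure_up_set_le:
  fixes P Q :: "real measure"
  assumes "prob_space P" "prob_space Q" and [measurable_cong]: "sets P = sets borel" "sets Q = sets borel"
    and [measurable]: "S \<in> sets borel" "D \<in> sets borel" and Q: "measure Q S = 1"
    and le: "\<And>u. u \<in> S \<Longrightarrow> measure P {u..} \<le> measure Q {u..}"
    and D: "D \<subseteq> S" "\<And>u v. u \<in> D \<Longrightarrow> v \<in> S \<Longrightarrow> u \<le> v \<Longrightarrow> v \<in> D"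
  shows "measure P D \<le> measure Q D"
proof -
  interpret P: prob_space P by fact
  interpret Q: prob_space Q by fact
  have "AE x in Q. x \<in> S" using Q by (subst Q.prob_eq_1[symmetric]) auto
  then have QD: "measure Q {u..} \<le> measure Q D" if "u \<in> D" for u
    using D(2)[OF that] by (intro Q.finite_measure_mono_AE) auto
  have PQ: "measure P {u..} \<le> measure Q D" if "u \<in> D" for u
    using le[of u] QD[OF that] that D(1) by auto
  show ?thesis
  proof (cases "D = {} \<or> \<not> bdd_below D")
    case True
    \<comment> \<open>An up-set of \<open>S\<close> that is unbounded below is all of
      \<open>S\<close>, which has full mass under \<open>Q\<close>.\<close>
    then consider "D = {}" | "D = S"
    proof
      assume "\<not> bdd_below D"
      then have "\<exists>u\<in>D. u \<le> v" for v by (auto simp: bdd_below_def) (meson linear)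
      then have "S \<subseteq> D" using D(2) by blast
      with D(1) show ?thesis using that by blast
    qed blast
    then show ?thesis using Q by cases auto
  next
    case False
    define i where "i = Inf D"
    have bdd: "bdd_below D" "D \<noteq> {}" using False by auto
    have i: "i \<le> x" if "x \<in> D" for x unfolding i_def using that bdd by (intro cInf_lower)
    show ?thesis
    proof (cases "i \<in> D")
      case True
      then have "measure P D \<le> measure P {i..}" using i by (intro P.finite_measure_mono) auto
      with PQ[OF True] show ?thesis by simp
    next
      case False
      \<comment> \<open>The part of \<open>D\<close> that a ray from a point near \<open>i\<close>
        can miss. These slices shrink to the empty set because \<open>i\<close> is not in
        \<open>D\<close>.\<close>
      define F where "F n = D \<inter> {..< i + 1 / real (Suc n)}" for n
      have "(\<lambda>n. measure P (F n)) \<longlonglongrightarrow> measure P (\<Inter>n. F n)"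
        by (intro P.finite_Lim_measure_decseq)
           (auto simp: F_def decseq_def frac_le elim!: order.strict_trans2)
      moreover have "(\<Inter>n. F n) = {}"
      proof (rule ccontr)
        assume "(\<Inter>n. F n) \<noteq> {}"
        then obtain x where x: "\<And>n. x \<in> F n" by auto
        then have "x \<in> D" by (auto simp: F_def)
        then have "i < x" using i[of x] False by (cases "i = x") auto
        then obtain n where "1 / real (Suc n) < x - i"
          using reals_Archimedean[of "x - i"] by (auto simp: inverse_eq_divide)
        with x[of n] show False by (auto simp: F_def)
      qed
      ultimately have "(\<lambda>n. measure P (F n) + measure Q D) \<longlonglongrightarrow> 0 + measure Q D"
        by (intro tendsto_add) auto
      moreover have "measure P D \<le> measure P (F n) + measure Q D" for n
      proof -
        have "Inf D < i + 1 / real (Suc n)" by (simp add: i_def)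
        then obtain u where u: "u \<in> D" "u < i + 1 / real (Suc n)"
          using cInf_less_iff[OF bdd(2,1)] by auto
        have "measure P D \<le> measure P (F n \<union> {u..})"
          using u by (intro P.finite_measure_mono) (auto simp: F_def)
        also have "\<dots> \<le> measure P (F n) + measure P {u..}"
          by (intro measure_Un_le) (auto simp: F_def)
        finally show ?thesis using PQ[OF u(1)] by simp
      qed
      ultimately show ?thesis using LIMSEQ_le_const by fastforce
    qed
  qed
qed

lemma nn_integral_layer_cake:
  fixes P :: "real measure"
  assumes "prob_space P" and sets_P[measurable_cong]: "sets P = sets borel"
    and [measurable]: "\<phi> \<in> borel_measurable borel" and nonneg: "\<And>x. (0::real) \<le> \<phi> x"
  shows "(\<integral>\<^sup>+x. ennreal (\<phi> x) \<partial>P) = (\<integral>\<^sup>+t\<in>{0..}. emeasure P {x. t < \<phi> x} \<partial>lborel)"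
proof -
  interpret P: prob_space P by fact
  interpret pair_sigma_finite P lborel ..
  have sp: "space P = UNIV" using sets_eq_imp_space_eq[OF sets_P] by simp
  have "(\<integral>\<^sup>+x. ennreal (\<phi> x) \<partial>P) = (\<integral>\<^sup>+x. (\<integral>\<^sup>+t. indicator {0..<\<phi> x} t \<partial>lborel) \<partial>P)"
    using nonneg by (intro nn_integral_cong) simp
  also have "\<dots> = (\<integral>\<^sup>+x. (\<integral>\<^sup>+t. indicator {z. 0 \<le> snd z \<and> snd z < \<phi> (fst z)} (x, t) \<partial>lborel) \<partial>P)"
    by (intro nn_integral_cong) (auto split: split_indicator)
  also have "\<dots> = (\<integral>\<^sup>+t. (\<integral>\<^sup>+x. indicator {z. 0 \<le> snd z \<and> snd z < \<phi> (fst z)} (x, t) \<partial>P) \<partial>lborel)"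
    by (rule Fubini'[symmetric]) (use sp in \<open>simp add: split_beta'\<close>)
  also have "\<dots> = (\<integral>\<^sup>+t. (\<integral>\<^sup>+x. indicator {0..} t * indicator {x. t < \<phi> x} x \<partial>P) \<partial>lborel)"
    by (intro nn_integral_cong) (auto split: split_indicator)
  also have "\<dots> = (\<integral>\<^sup>+t. indicator {0..} t * emeasure P {x. t < \<phi> x} \<partial>lborel)"
    by (intro nn_integral_cong) (simp add: nn_integral_cmult)
  finally show ?thesis by (simp add: mult.commute)
qed

text \<open>By the layer cake formula it is enough to compare superlevel sets of
  \<open>\<phi>\<close>. Only their traces on \<open>S\<close> are up-sets, since
  \<open>\<phi>\<close> is monotone only there; full mass of \<open>S\<close> makes passing to the
  traces harmless.\<close>

lemma stochastic_dominance_integral: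
  fixes P Q :: "real measure"
  assumes "prob_space P" "prob_space Q" and [measurable_cong]: "sets P = sets borel" "sets Q = sets borel"
    and S[measurable]: "S \<in> sets borel" and 1: "measure P S = 1" "measure Q S = 1"
    and le: "\<And>u. u \<in> S \<Longrightarrow> measure P {u..} \<le> measure Q {u..}"
    and \<phi>[measurable]: "\<phi> \<in> borel_measurable borel" and \<phi>_mono: "mono_on S \<phi>"
    and nonneg: "\<And>x. (0::real) \<le> \<phi> x"
  shows "(\<integral>\<^sup>+x. ennreal (\<phi> x) \<partial>P) \<le> (\<integral>\<^sup>+x. ennreal (\<phi> x) \<partial>Q)"
proof -
  interpret P: prob_space P by fact
  interpret Q: prob_space Q by fact
  have PS: "AE x in P. x \<in> S" "AE x in Q. x \<in> S"
    using 1 by (subst P.prob_eq_1[symmetric] Q.prob_eq_1[symmetric]; simp)+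
  have "emeasure P {x. t < \<phi> x} \<le> emeasure Q {x. t < \<phi> x}" for t
  proof -
    have D: "{x \<in> S. t < \<phi> x} \<in> sets borel" by measurable
    have "emeasure P {x. t < \<phi> x} \<le> emeasure P {x \<in> S. t < \<phi> x}"
      by (rule emeasure_mono_AE) (use PS in auto)
    also have "\<dots> \<le> emeasure Q {x \<in> S. t < \<phi> x}"
      unfolding P.emeasure_eq_measure Q.emeasure_eq_measure
    proof (rule ennreal_leI, rule measure_up_set_le[where S = S])
      show "v \<in> {x \<in> S. t < \<phi> x}" if "u \<in> {x \<in> S. t < \<phi> x}" "v \<in> S" "u \<le> v" for u v
        using that mono_onD[OF \<phi>_mono, of u v] by auto
    qed (fact D | fact assms | rule le | blast)+
    also have "\<dots> \<le> emeasure Q {x. t < \<phi> x}"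
      by (rule emeasure_mono) auto
    finally show ?thesis .
  qed
  then show ?thesis
    unfolding nn_integral_layer_cake[OF assms(1,3) \<phi> nonneg] nn_integral_layer_cake[OF assms(2,4) \<phi> nonneg]
    by (intro nn_integral_mono mult_right_mono) auto
qed

section \<open>Conditional independence\<close>

lemma measurable_sigma_gen: "X \<in> measurable (sigma_gen M X) borel"
  unfolding sigma_gen_def by (rule measurable_vimage_algebra1) auto

lemma sigma_finite_subalgebra_vimage:
  assumes "prob_space M" "X \<in> M \<rightarrow>\<^sub>M borel"
  shows "sigma_finite_subalgebra M (vimage_algebra (space M) X borel)"
proof -
  interpret prob_space M by fact
  have "finite_measure_subalgebra M (vimage_algebra (space M) X borel)"
    by unfold_locales (use assms(2) in \<open>auto simp: subalgebra_def sets_vimage_algebra2\<close>)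
  then show ?thesis by (rule finite_measure_subalgebra_is_sigma_finite)
qed

lemma sigma_finite_subalgebra_sigma_gen:
  "prob_space M \<Longrightarrow> X \<in> borel_measurable M \<Longrightarrow> sigma_finite_subalgebra M (sigma_gen M X)"
  unfolding sigma_gen_def by (rule sigma_finite_subalgebra_vimage)

text \<open>Sets of the generated algebra are exactly the preimages under \<open>X\<close>, so tests
  against indicators of \<open>X\<close> are enough. The type of \<open>X\<close> is general because
  pairs such as \<open>(A, Y)\<close> and \<open>(Y1, Y0)\<close> also have to be conditioned
  on.\<close>

lemma real_cond_exp_vimageI:
  fixes X :: "'w \<Rightarrow> 'b::topological_space"
  assumes M: "prob_space M" and X[measurable]: "X \<in> M \<rightarrow>\<^sub>M borel"
    and f: "integrable M f" and g: "integrable M g" "g \<in> borel_measurable (vimage_algebra (space M) X borel)"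
    and eq: "\<And>B. B \<in> sets borel \<Longrightarrow>
      (\<integral>\<omega>. indicator B (X \<omega>) * f \<omega> \<partial>M) = (\<integral>\<omega>. indicator B (X \<omega>) * g \<omega> \<partial>M)"
  shows "AE \<omega> in M. real_cond_exp M (vimage_algebra (space M) X borel) f \<omega> = g \<omega>"
proof -
  interpret sigma_finite_subalgebra M "vimage_algebra (space M) X borel"
    by (rule sigma_finite_subalgebra_vimage) fact+
  show ?thesis
  proof (rule real_cond_exp_charact)
    fix A assume "A \<in> sets (vimage_algebra (space M) X borel)"
    then obtain B where B: "B \<in> sets borel" "A = X -` B \<inter> space M"
      by (auto simp: sets_vimage_algebra2)
    have "set_lebesgue_integral M A h = (\<integral>\<omega>. indicator B (X \<omega>) * h \<omega> \<partial>M)" for h :: "'w \<Rightarrow> real"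
      unfolding set_lebesgue_integral_def B(2)
      by (intro Bochner_Integration.integral_cong) (auto split: split_indicator)
    then show "set_lebesgue_integral M A f = set_lebesgue_integral M A g" using eq[OF B(1)] by simp
  qed fact+
qed

text \<open>The hypothesis says that \<open>J\<close> has conditional expectation zero given
  \<open>X\<close>, and \<open>\<phi> (X \<omega>)\<close> can be pulled out. This passes from
  events to integrable functions without approximation by simple functions.\<close>

lemma integral_mult_vimage_eq_0:
  fixes X :: "'w \<Rightarrow> 'b::topological_space" and \<phi> :: "'b \<Rightarrow> real"
  assumes M: "prob_space M" and X[measurable]: "X \<in> M \<rightarrow>\<^sub>M borel"
    and J: "integrable M J" and \<phi>: "\<phi> \<in> borel_measurable borel" "integrable M (\<lambda>\<omega>. \<phi> (X \<omega>) * J \<omega>)"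
    and eq: "\<And>B. B \<in> sets borel \<Longrightarrow> (\<integral>\<omega>. indicator B (X \<omega>) * J \<omega> \<partial>M) = 0"
  shows "(\<integral>\<omega>. \<phi> (X \<omega>) * J \<omega> \<partial>M) = 0"
proof -
  let ?F = "vimage_algebra (space M) X borel"
  interpret sigma_finite_subalgebra M ?F
    by (rule sigma_finite_subalgebra_vimage) fact+
  have "X \<in> ?F \<rightarrow>\<^sub>M borel" by (rule measurable_vimage_algebra1) auto
  then have "(\<lambda>\<omega>. \<phi> (X \<omega>)) \<in> borel_measurable ?F" using \<phi>(1) by (rule measurable_compose)
  then have "(\<integral>\<omega>. \<phi> (X \<omega>) * J \<omega> \<partial>M) = (\<integral>\<omega>. \<phi> (X \<omega>) * real_cond_exp M ?F J \<omega> \<partial>M)"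
    using J by (intro real_cond_exp_intg(2)[symmetric] \<phi>) auto
  also have "AE \<omega> in M. real_cond_exp M ?F J \<omega> = 0"
    by (rule real_cond_exp_vimageI) (use assms in auto)
  then have "(\<integral>\<omega>. \<phi> (X \<omega>) * real_cond_exp M ?F J \<omega> \<partial>M) = 0"
    by (intro integral_eq_zero_AE) auto
  finally show ?thesis .
qed

lemma integrable_mult_bounded:
  fixes f g :: "'w \<Rightarrow> real"
  assumes "integrable M f" "g \<in> borel_measurable M" "AE \<omega> in M. \<bar>g \<omega>\<bar> \<le> B"
  shows "integrable M (\<lambda>\<omega>. f \<omega> * g \<omega>)"
proof (rule Bochner_Integration.integrable_bound)
  show "integrable M (\<lambda>\<omega>. B * f \<omega>)" using assms by auto
  show "AE \<omega> in M. norm (f \<omega> * g \<omega>) \<le> norm (B * f \<omega>)"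
    using assms(3)
  proof eventually_elim
    case (elim \<omega>)
    then have "\<bar>g \<omega>\<bar> \<le> \<bar>B\<bar>" by linarith
    then show ?case
      using mult_left_mono[of "\<bar>g \<omega>\<bar>" "\<bar>B\<bar>" "\<bar>f \<omega>\<bar>"] by (simp add: abs_mult mult.commute)
  qed
qed (use assms in auto)

lemma real_cond_exp_between:
  assumes "sigma_finite_subalgebra M F" "integrable M f" "AE \<omega> in M. a \<le> f \<omega> \<and> f \<omega> \<le> b"
  shows "AE \<omega> in M. a \<le> real_cond_exp M F f \<omega> \<and> real_cond_exp M F f \<omega> \<le> b"
proof -
  interpret sigma_finite_subalgebra M F by fact
  have "AE \<omega> in M. a \<le> f \<omega>" "AE \<omega> in M. f \<omega> \<le> b" using assms(3) by auto
  then show ?thesis using real_cond_exp_ge_c[OF assms(2)] real_cond_exp_le_c[OF assms(2)] by auto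
qed

text \<open>The residual \<open>J\<close> of the indicator of \<open>D\<close> given
  \<open>V\<close> is orthogonal to functions of \<open>X\<close> and \<open>V\<close> jointly. This
  is shown for products of events, extended to functions of \<open>X\<close> while the event in
  \<open>V\<close> is fixed, and then to the factor \<open>k\<close>.\<close>

lemma cond_indep_integral:
  fixes X :: "'w \<Rightarrow> 'b::topological_space" and Z :: "'w \<Rightarrow> 'c::topological_space" and \<phi> :: "'b \<Rightarrow> real"
  assumes M: "prob_space M" and X[measurable]: "X \<in> M \<rightarrow>\<^sub>M borel" and Z[measurable]: "Z \<in> M \<rightarrow>\<^sub>M borel"
    and V[measurable]: "V \<in> borel_measurable M" and ci: "cond_indep M X Z V"
    and \<phi>[measurable]: "\<phi> \<in> borel_measurable borel" and int: "integrable M (\<lambda>\<omega>. \<phi> (X \<omega>))"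
    and k: "k \<in> borel_measurable (sigma_gen M V)" "integrable M (\<lambda>\<omega>. \<phi> (X \<omega>) * k \<omega>)"
    and D[measurable]: "D \<in> sets borel"
  shows "(\<integral>\<omega>. \<phi> (X \<omega>) * k \<omega> * indicator D (Z \<omega>) \<partial>M) =
    (\<integral>\<omega>. \<phi> (X \<omega>) * k \<omega> * real_cond_exp M (sigma_gen M V) (\<lambda>\<omega>. indicator D (Z \<omega>)) \<omega> \<partial>M)"
proof -
  interpret prob_space M by fact
  let ?F = "sigma_gen M V"
  interpret F: sigma_finite_subalgebra M ?F
    by (rule sigma_finite_subalgebra_sigma_gen) fact+
  define e where "e = real_cond_exp M ?F (\<lambda>\<omega>. indicator D (Z \<omega>))"
  define J where "J \<omega> = indicator D (Z \<omega>) - e \<omega>" for \<omega>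
  have iD: "integrable M (\<lambda>\<omega>. indicator D (Z \<omega>) :: real)"
    by (rule integrable_const_bound[of _ 1]) auto
  have eF[measurable]: "e \<in> borel_measurable ?F" unfolding e_def by simp
  have eM[measurable]: "e \<in> borel_measurable M" unfolding e_def by simp
  have kM[measurable]: "k \<in> borel_measurable M" by (rule measurable_from_subalg[OF F.subalg k(1)])
  have [measurable]: "J \<in> borel_measurable M" unfolding J_def by measurable
  have e01: "AE \<omega> in M. 0 \<le> e \<omega> \<and> e \<omega> \<le> 1"
    unfolding e_def by (rule real_cond_exp_between) (use iD F.sigma_finite_subalgebra_axioms in auto)
  then have J1: "AE \<omega> in M. \<bar>J \<omega>\<bar> \<le> 1"
    by eventually_elim (auto simp: J_def split: split_indicator)
  have iJ: "integrable M J"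
    by (rule integrable_const_bound[of _ 1]) (use J1 in auto)
  \<comment> \<open>The event in \<open>V\<close> is attached to \<open>J\<close>, so that only
    \<open>X\<close> remains as the variable being tested.\<close>
  have J_E: "(\<integral>\<omega>. indicator E (V \<omega>) * (\<phi> (X \<omega>) * J \<omega>) \<partial>M) = 0" if [measurable]: "E \<in> sets borel" for E
  proof -
    have iE: "(\<lambda>\<omega>. indicator E (V \<omega>) :: real) \<in> borel_measurable ?F"
      by (rule measurable_compose[OF measurable_sigma_gen]) simp
    have "(\<integral>\<omega>. \<phi> (X \<omega>) * (indicator E (V \<omega>) * J \<omega>) \<partial>M) = 0"
    proof (rule integral_mult_vimage_eq_0[OF M X _ \<phi>])
      show "integrable M (\<lambda>\<omega>. indicator E (V \<omega>) * J \<omega>)"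
        by (subst mult.commute, rule integrable_mult_bounded[where B = 1, OF iJ])
           (auto split: split_indicator)
      show "integrable M (\<lambda>\<omega>. \<phi> (X \<omega>) * (indicator E (V \<omega>) * J \<omega>))"
        by (rule integrable_mult_bounded[where B = 1, OF int])
           (use J1 in \<open>auto split: split_indicator\<close>)
      fix B :: "'b set" assume [measurable]: "B \<in> sets borel"
      have iB: "integrable M (\<lambda>\<omega>. indicator B (X \<omega>) :: real)"
        by (rule integrable_const_bound[of _ 1]) auto
      have iB1: "integrable M (\<lambda>\<omega>. h \<omega> * indicator B (X \<omega>))" if "integrable M h" for h :: "'w \<Rightarrow> real"
        by (rule integrable_mult_bounded[where B = 1, OF that]) (auto split: split_indicator)
      have iE1: "integrable M (\<lambda>\<omega>. indicator E (V \<omega>) * h \<omega>)" if "integrable M h" for h :: "'w \<Rightarrow> real"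
        by (subst mult.commute, rule integrable_mult_bounded[where B = 1, OF that])
           (auto split: split_indicator)
      have ie: "integrable M e" unfolding e_def using iD by auto
      have "(\<integral>\<omega>. indicator E (V \<omega>) * (indicator B (X \<omega>) * indicator D (Z \<omega>)) \<partial>M) =
          (\<integral>\<omega>. indicator E (V \<omega>) * real_cond_exp M ?F (\<lambda>\<omega>. indicator B (X \<omega>) * indicator D (Z \<omega>)) \<omega> \<partial>M)"
        by (intro F.real_cond_exp_intg(2)[symmetric] iE iE1)
           (use iB1[OF iD] in \<open>auto simp: mult.commute\<close>)
      \<comment> \<open>The product formula of conditional independence. Since its cofactor is
        measurable with respect to \<open>V\<close>, the remaining conditional expectation can then
        be replaced by the indicator of \<open>B\<close>.\<close>
      also have "\<dots> = (\<integral>\<omega>. (indicator E (V \<omega>) * e \<omega>) * real_cond_exp M ?F (\<lambda>\<omega>. indicator B (X \<omega>)) \<omega> \<partial>M)"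
      proof (intro integral_cong_AE)
        show "AE \<omega> in M. indicator E (V \<omega>) * real_cond_exp M ?F (\<lambda>\<omega>. indicator B (X \<omega>) * indicator D (Z \<omega>)) \<omega>
            = indicator E (V \<omega>) * e \<omega> * real_cond_exp M ?F (\<lambda>\<omega>. indicator B (X \<omega>)) \<omega>"
          using ci[unfolded cond_indep_def, rule_format, of B D] by (auto simp: e_def)
      qed auto
      also have "\<dots> = (\<integral>\<omega>. (indicator E (V \<omega>) * e \<omega>) * indicator B (X \<omega>) \<partial>M)"
        by (intro F.real_cond_exp_intg(2) iB1 iE1 ie borel_measurable_times iE eF) auto
      finally have "(\<integral>\<omega>. indicator E (V \<omega>) * (indicator B (X \<omega>) * indicator D (Z \<omega>)) \<partial>M) = \<dots>" .
      moreover have "(\<integral>\<omega>. indicator B (X \<omega>) * (indicator E (V \<omega>) * J \<omega>) \<partial>M) =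
          (\<integral>\<omega>. indicator E (V \<omega>) * (indicator B (X \<omega>) * indicator D (Z \<omega>)) - (indicator E (V \<omega>) * e \<omega>) * indicator B (X \<omega>) \<partial>M)"
        by (intro Bochner_Integration.integral_cong) (auto simp: J_def algebra_simps)
      moreover have "\<dots> = (\<integral>\<omega>. indicator E (V \<omega>) * (indicator B (X \<omega>) * indicator D (Z \<omega>)) \<partial>M)
          - (\<integral>\<omega>. (indicator E (V \<omega>) * e \<omega>) * indicator B (X \<omega>) \<partial>M)"
        by (intro Bochner_Integration.integral_diff iB1 iE1 ie)
           (use iB1[OF iD] in \<open>auto simp: mult.commute\<close>)
      ultimately show "(\<integral>\<omega>. indicator B (X \<omega>) * (indicator E (V \<omega>) * J \<omega>) \<partial>M) = 0" by simp
    qed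
    then show ?thesis by (simp add: ac_simps)
  qed
  have i\<phi>J: "integrable M (\<lambda>\<omega>. \<phi> (X \<omega>) * J \<omega>)"
    by (rule integrable_mult_bounded[where B = 1, OF int]) (use J1 in auto)
  \<comment> \<open>Vanishing over all events of \<open>V\<close> means conditional expectation zero
    given \<open>V\<close>, so a further factor \<open>k\<close> measurable with respect to
    \<open>V\<close> may be inserted.\<close>
  have "AE \<omega> in M. real_cond_exp M ?F (\<lambda>\<omega>. \<phi> (X \<omega>) * J \<omega>) \<omega> = 0"
    unfolding sigma_gen_def by (rule real_cond_exp_vimageI) (use M i\<phi>J J_E in auto)
  moreover have "integrable M (\<lambda>\<omega>. k \<omega> * (\<phi> (X \<omega>) * J \<omega>))"
    using integrable_mult_bounded[OF k(2) _ J1] by (simp add: ac_simps)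
  then have "(\<integral>\<omega>. k \<omega> * (\<phi> (X \<omega>) * J \<omega>) \<partial>M) =
      (\<integral>\<omega>. k \<omega> * real_cond_exp M ?F (\<lambda>\<omega>. \<phi> (X \<omega>) * J \<omega>) \<omega> \<partial>M)"
    by (intro F.real_cond_exp_intg(2)[symmetric] k) auto
  ultimately have "(\<integral>\<omega>. k \<omega> * (\<phi> (X \<omega>) * J \<omega>) \<partial>M) = 0"
    by (auto intro!: integral_eq_zero_AE)
  moreover have "(\<integral>\<omega>. k \<omega> * (\<phi> (X \<omega>) * J \<omega>) \<partial>M) =
      (\<integral>\<omega>. \<phi> (X \<omega>) * k \<omega> * indicator D (Z \<omega>) - \<phi> (X \<omega>) * k \<omega> * e \<omega> \<partial>M)"
    by (intro Bochner_Integration.integral_cong) (auto simp: J_def algebra_simps)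
  moreover have "\<dots> = (\<integral>\<omega>. \<phi> (X \<omega>) * k \<omega> * indicator D (Z \<omega>) \<partial>M) - (\<integral>\<omega>. \<phi> (X \<omega>) * k \<omega> * e \<omega> \<partial>M)"
    by (intro Bochner_Integration.integral_diff integrable_mult_bounded[where B = 1, OF k(2)])
       (use e01 in \<open>auto split: split_indicator\<close>)
  ultimately show ?thesis by (simp add: e_def)
qed

lemma cond_indep_sym: "cond_indep M X Z V \<Longrightarrow> cond_indep M Z X V"
  unfolding cond_indep_def by (simp add: mult.commute)

text \<open>A factor depending on \<open>C\<close> does not notice the replacement of
  \<open>\<phi> (X \<omega>)\<close> by its conditional expectation given \<open>V\<close>. For an
  event in \<open>C\<close>, replace its indicator by the conditional expectation \<open>?d\<close>
  given \<open>V\<close>, move the conditioning over to \<open>\<phi> (X \<omega>)\<close> by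
  self-adjointness, and turn \<open>?d\<close> back into the indicator. Hence the difference of the
  two integrands has conditional expectation zero given \<open>C\<close>, which admits every bounded
  \<open>x\<close>.\<close>

lemma cond_indep_integral_cond_exp:
  fixes X :: "'w \<Rightarrow> 'b::topological_space" and \<phi> :: "'b \<Rightarrow> real"
  assumes M: "prob_space M" and X[measurable]: "X \<in> M \<rightarrow>\<^sub>M borel" and C[measurable]: "C \<in> borel_measurable M"
    and V[measurable]: "V \<in> borel_measurable M" and ci: "cond_indep M C X V"
    and \<phi>[measurable]: "\<phi> \<in> borel_measurable borel" and int: "integrable M (\<lambda>\<omega>. \<phi> (X \<omega>))"
    and k: "k \<in> borel_measurable (sigma_gen M V)" "integrable M (\<lambda>\<omega>. \<phi> (X \<omega>) * k \<omega>)"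
    and x: "x \<in> borel_measurable (sigma_gen M C)" "AE \<omega> in M. \<bar>x \<omega>\<bar> \<le> B"
    and e: "AE \<omega> in M. real_cond_exp M (sigma_gen M V) (\<lambda>\<omega>. \<phi> (X \<omega>)) \<omega> = e \<omega>" "e \<in> borel_measurable M"
  shows "integrable M (\<lambda>\<omega>. e \<omega> * k \<omega>)"
    and "(\<integral>\<omega>. \<phi> (X \<omega>) * k \<omega> * x \<omega> \<partial>M) = (\<integral>\<omega>. e \<omega> * k \<omega> * x \<omega> \<partial>M)"
proof -
  interpret prob_space M by fact
  let ?F = "sigma_gen M V"
  interpret F: sigma_finite_subalgebra M ?F
    by (rule sigma_finite_subalgebra_sigma_gen) fact+
  interpret G: sigma_finite_subalgebra M "sigma_gen M C"
    by (rule sigma_finite_subalgebra_sigma_gen) fact+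
  let ?e = "real_cond_exp M ?F (\<lambda>\<omega>. \<phi> (X \<omega>))"
  have [measurable]: "k \<in> borel_measurable M" by (rule measurable_from_subalg[OF F.subalg k(1)])
  have [measurable]: "x \<in> borel_measurable M" by (rule measurable_from_subalg[OF G.subalg x(1)])
  note [measurable] = e(2)
  have k\<phi>: "integrable M (\<lambda>\<omega>. k \<omega> * \<phi> (X \<omega>))" using k(2) by (simp add: mult.commute)
  have ik: "integrable M (\<lambda>\<omega>. k \<omega> * ?e \<omega>)"
    by (rule F.real_cond_exp_intg(1)[OF k\<phi> k(1)]) simp
  show iek: "integrable M (\<lambda>\<omega>. e \<omega> * k \<omega>)"
    using ik by (rule integrable_cong_AE_imp) (use e in auto)
  have "(\<integral>\<omega>. indicator D (C \<omega>) * (\<phi> (X \<omega>) * k \<omega>) \<partial>M) = (\<integral>\<omega>. indicator D (C \<omega>) * (e \<omega> * k \<omega>) \<partial>M)"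
    if D[measurable]: "D \<in> sets borel" for D
  proof -
    let ?d = "real_cond_exp M ?F (\<lambda>\<omega>. indicator D (C \<omega>))"
    have iD: "integrable M (\<lambda>\<omega>. indicator D (C \<omega>) :: real)"
      by (rule integrable_const_bound[of _ 1]) auto
    have d01: "AE \<omega> in M. \<bar>?d \<omega>\<bar> \<le> 1"
      using real_cond_exp_between[OF F.sigma_finite_subalgebra_axioms iD, of 0 1] by (auto split: split_indicator)
    have "(\<integral>\<omega>. indicator D (C \<omega>) * (\<phi> (X \<omega>) * k \<omega>) \<partial>M) = (\<integral>\<omega>. \<phi> (X \<omega>) * k \<omega> * ?d \<omega> \<partial>M)"
      using cond_indep_integral[OF M X C V cond_indep_sym[OF ci] \<phi> int k D] by (simp add: ac_simps)
    also have "\<dots> = (\<integral>\<omega>. (k \<omega> * ?d \<omega>) * \<phi> (X \<omega>) \<partial>M)" by (simp add: ac_simps)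
    also have "\<dots> = (\<integral>\<omega>. (k \<omega> * ?d \<omega>) * ?e \<omega> \<partial>M)"
      using integrable_mult_bounded[OF k(2) _ d01] k(1)
      by (intro F.real_cond_exp_intg(2)[symmetric]) (auto simp: ac_simps)
    also have "\<dots> = (\<integral>\<omega>. (k \<omega> * ?e \<omega>) * ?d \<omega> \<partial>M)" by (simp add: ac_simps)
    also have "\<dots> = (\<integral>\<omega>. (k \<omega> * ?e \<omega>) * indicator D (C \<omega>) \<partial>M)"
      using k(1) by (intro F.real_cond_exp_intg(2) integrable_mult_bounded[where B = 1, OF ik])
        (auto split: split_indicator)
    also have "\<dots> = (\<integral>\<omega>. indicator D (C \<omega>) * (e \<omega> * k \<omega>) \<partial>M)"
      by (rule integral_cong_AE) (use e in auto)
    finally show ?thesis .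
  qed
  then have "(\<integral>\<omega>. indicator D (C \<omega>) * (\<phi> (X \<omega>) * k \<omega> - e \<omega> * k \<omega>) \<partial>M) = 0" if [measurable]: "D \<in> sets borel" for D
    using integrable_mult_bounded[where B = 1, OF k(2), of "\<lambda>\<omega>. indicator D (C \<omega>)"]
      integrable_mult_bounded[where B = 1, OF iek, of "\<lambda>\<omega>. indicator D (C \<omega>)"] that
    by (simp add: right_diff_distrib mult.commute split: split_indicator)
  then have "AE \<omega> in M. real_cond_exp M (sigma_gen M C) (\<lambda>\<omega>. \<phi> (X \<omega>) * k \<omega> - e \<omega> * k \<omega>) \<omega> = 0"
    unfolding sigma_gen_def by (intro real_cond_exp_vimageI[OF M C] Bochner_Integration.integrable_diff k iek) auto
  moreover have "integrable M (\<lambda>\<omega>. x \<omega> * (\<phi> (X \<omega>) * k \<omega> - e \<omega> * k \<omega>))"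
    by (subst mult.commute, rule integrable_mult_bounded[OF Bochner_Integration.integrable_diff[OF k(2) iek] _ x(2)]) simp
  then have "(\<integral>\<omega>. x \<omega> * (\<phi> (X \<omega>) * k \<omega> - e \<omega> * k \<omega>) \<partial>M) =
     (\<integral>\<omega>. x \<omega> * real_cond_exp M (sigma_gen M C) (\<lambda>\<omega>. \<phi> (X \<omega>) * k \<omega> - e \<omega> * k \<omega>) \<omega> \<partial>M)"
    by (intro G.real_cond_exp_intg(2)[symmetric] x) auto
  ultimately have 0: "(\<integral>\<omega>. x \<omega> * (\<phi> (X \<omega>) * k \<omega> - e \<omega> * k \<omega>) \<partial>M) = 0"
    by (auto intro!: integral_eq_zero_AE)
  have "(\<integral>\<omega>. x \<omega> * (\<phi> (X \<omega>) * k \<omega> - e \<omega> * k \<omega>) \<partial>M) =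
      (\<integral>\<omega>. \<phi> (X \<omega>) * k \<omega> * x \<omega> \<partial>M) - (\<integral>\<omega>. e \<omega> * k \<omega> * x \<omega> \<partial>M)"
    unfolding Bochner_Integration.integral_diff[symmetric,
        OF integrable_mult_bounded[OF k(2) _ x(2)] integrable_mult_bounded[OF iek _ x(2)], simplified]
    by (intro Bochner_Integration.integral_cong) (auto simp: algebra_simps)
  with 0 show "(\<integral>\<omega>. \<phi> (X \<omega>) * k \<omega> * x \<omega> \<partial>M) = (\<integral>\<omega>. e \<omega> * k \<omega> * x \<omega> \<partial>M)" by simp
qed

section \<open>Stochastic monotonicity\<close>

text \<open>The common consequence of both dependence assumptions. The carrying set \<open>T\<close>
  is chosen after \<open>\<phi>\<close>, because the exceptional null set of a conditional
  expectation may vary with \<open>\<phi>\<close>. The range between 0 and 1 secures integrability;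
  truncated functions are brought into it by affine rescaling.\<close>

definition stoch_increasing :: "'w measure \<Rightarrow> real set \<Rightarrow> ('w \<Rightarrow> real) \<Rightarrow> ('w \<Rightarrow> real) \<Rightarrow> bool" where
  "stoch_increasing M S U C \<longleftrightarrow>
    (\<forall>\<phi> \<in> borel_measurable borel. mono_on S \<phi> \<longrightarrow> (\<forall>x. 0 \<le> \<phi> x \<and> \<phi> x \<le> (1::real)) \<longrightarrow>
      (\<exists>\<psi> T. mono_on T \<psi> \<and> (AE \<omega> in M. C \<omega> \<in> T) \<and>
        (AE \<omega> in M. real_cond_exp M (sigma_gen M C) (\<lambda>\<omega>. \<phi> (U \<omega>)) \<omega> = \<psi> (C \<omega>))))"

text \<open>Testing with extended nonnegative integrals avoids a prior integrability proof for
  \<open>\<psi>\<close>: the test on the whole line bounds its integral by that of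
  \<open>\<phi>\<close>, so infinite values, which \<open>enn2real\<close> sends to 0, occur only on
  a null set.\<close>

lemma real_cond_exp_sigma_genI:
  fixes \<phi> :: "real \<Rightarrow> real" and \<psi> :: "real \<Rightarrow> ennreal"
  assumes M: "prob_space M" and [measurable]: "U \<in> borel_measurable M" "C \<in> borel_measurable M"
    and [measurable]: "\<phi> \<in> borel_measurable borel" "\<psi> \<in> borel_measurable borel"
    and \<phi>: "\<And>x. 0 \<le> \<phi> x \<and> \<phi> x \<le> 1"
    and eq: "\<And>D. D \<in> sets borel \<Longrightarrow>
      (\<integral>\<^sup>+\<omega>. ennreal (\<phi> (U \<omega>)) * indicator D (C \<omega>) \<partial>M) = (\<integral>\<^sup>+\<omega>. \<psi> (C \<omega>) * indicator D (C \<omega>) \<partial>M)"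
  shows "AE \<omega> in M. real_cond_exp M (sigma_gen M C) (\<lambda>\<omega>. \<phi> (U \<omega>)) \<omega> = enn2real (\<psi> (C \<omega>))"
proof -
  interpret prob_space M by fact
  have i\<phi>: "integrable M (\<lambda>\<omega>. \<phi> (U \<omega>))"
    by (rule integrable_const_bound[of _ 1]) (use \<phi> in auto)
  have fin: "(\<integral>\<^sup>+\<omega>. \<psi> (C \<omega>) \<partial>M) < \<infinity>"
  proof -
    have "(\<integral>\<^sup>+\<omega>. \<psi> (C \<omega>) \<partial>M) = (\<integral>\<^sup>+\<omega>. ennreal (\<phi> (U \<omega>)) \<partial>M)"
      using eq[of UNIV] by simp
    also have "\<dots> < \<infinity>" using i\<phi> \<phi> by (subst nn_integral_eq_integral) auto
    finally show ?thesis .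
  qed
  then have fin_AE: "AE \<omega> in M. \<psi> (C \<omega>) \<noteq> \<infinity>" by (intro nn_integral_PInf_AE) auto
  have i\<psi>: "integrable M (\<lambda>\<omega>. enn2real (\<psi> (C \<omega>)))"
  proof (rule integrableI_nonneg)
    have "(\<integral>\<^sup>+\<omega>. ennreal (enn2real (\<psi> (C \<omega>))) \<partial>M) = (\<integral>\<^sup>+\<omega>. \<psi> (C \<omega>) \<partial>M)"
      by (rule nn_integral_cong_AE) (use fin_AE in \<open>auto simp: less_top\<close>)
    then show "(\<integral>\<^sup>+\<omega>. ennreal (enn2real (\<psi> (C \<omega>))) \<partial>M) < \<infinity>" using fin by simp
  qed auto
  show ?thesis
    unfolding sigma_gen_def
  proof (rule real_cond_exp_vimageI)
    have "(\<lambda>x. enn2real (\<psi> x)) \<in> borel_measurable borel" by simp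
    from measurable_compose[OF measurable_sigma_gen[of C M] this]
    show "(\<lambda>\<omega>. enn2real (\<psi> (C \<omega>))) \<in> borel_measurable (vimage_algebra (space M) C borel)"
      by (simp add: sigma_gen_def)
    fix B :: "real set" assume [measurable]: "B \<in> sets borel"
    have "(\<integral>\<omega>. indicator B (C \<omega>) * \<phi> (U \<omega>) \<partial>M) = enn2real (\<integral>\<^sup>+\<omega>. ennreal (\<phi> (U \<omega>)) * indicator B (C \<omega>) \<partial>M)"
      using \<phi> by (subst integral_eq_nn_integral)
        (auto intro!: arg_cong[where f = enn2real] nn_integral_cong split: split_indicator)
    also have "\<dots> = enn2real (\<integral>\<^sup>+\<omega>. \<psi> (C \<omega>) * indicator B (C \<omega>) \<partial>M)" by (simp add: eq)
    also have "(\<integral>\<^sup>+\<omega>. \<psi> (C \<omega>) * indicator B (C \<omega>) \<partial>M) =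
        (\<integral>\<^sup>+\<omega>. ennreal (indicator B (C \<omega>) * enn2real (\<psi> (C \<omega>))) \<partial>M)"
      by (rule nn_integral_cong_AE) (use fin_AE in \<open>auto simp: less_top split: split_indicator\<close>)
    also have "enn2real \<dots> = (\<integral>\<omega>. indicator B (C \<omega>) * enn2real (\<psi> (C \<omega>)) \<partial>M)"
      by (subst integral_eq_nn_integral) auto
    finally show "(\<integral>\<omega>. indicator B (C \<omega>) * \<phi> (U \<omega>) \<partial>M) = (\<integral>\<omega>. indicator B (C \<omega>) * enn2real (\<psi> (C \<omega>)) \<partial>M)" .
  qed fact+
qed

text \<open>Two equalities of measures replace the usual induction over functions. With the event in
  \<open>U\<close> fixed, both sides define the same measure on values of \<open>C\<close>, which
  admits \<open>g\<close>; with \<open>g\<close> as density, both sides define the same measure on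
  values of \<open>U\<close>, which admits \<open>\<phi>\<close>.\<close>

lemma nn_integral_cond_distr:
  fixes \<phi> g :: "real \<Rightarrow> ennreal"
  assumes [measurable]: "U \<in> borel_measurable M" "C \<in> borel_measurable M"
    and \<kappa>: "is_cond_distr M U C \<kappa>"
    and [measurable]: "\<phi> \<in> borel_measurable borel" "g \<in> borel_measurable borel"
  shows "(\<integral>\<^sup>+\<omega>. \<phi> (U \<omega>) * g (C \<omega>) \<partial>M) = (\<integral>\<^sup>+\<omega>. (\<integral>\<^sup>+x. \<phi> x \<partial>\<kappa> (C \<omega>)) * g (C \<omega>) \<partial>M)"
proof -
  have \<kappa>_meas[measurable]: "\<kappa> \<in> borel \<rightarrow>\<^sub>M subprob_algebra borel"
    using \<kappa> by (auto simp: is_cond_distr_def intro: measurable_prob_algebraD)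
  have \<kappa>_eq: "emeasure M {\<omega> \<in> space M. U \<omega> \<in> B \<and> C \<omega> \<in> D} = (\<integral>\<^sup>+x\<in>D. emeasure (\<kappa> x) B \<partial>distr M borel C)"
    if "B \<in> sets borel" "D \<in> sets borel" for B D
    using \<kappa> that by (auto simp: is_cond_distr_def)
  have B: "(\<integral>\<^sup>+\<omega>. indicator B (U \<omega>) * g (C \<omega>) \<partial>M) = (\<integral>\<^sup>+\<omega>. emeasure (\<kappa> (C \<omega>)) B * g (C \<omega>) \<partial>M)"
    if [measurable]: "B \<in> sets borel" for B
  proof -
    have "distr (density M (\<lambda>\<omega>. indicator B (U \<omega>))) borel C = density (distr M borel C) (\<lambda>x. emeasure (\<kappa> x) B)"
    proof (rule measure_eqI)
      fix D assume "D \<in> sets (distr (density M (\<lambda>\<omega>. indicator B (U \<omega>))) borel C)"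
      then have [measurable]: "D \<in> sets borel" by simp
      have "emeasure (distr (density M (\<lambda>\<omega>. indicator B (U \<omega>))) borel C) D =
          (\<integral>\<^sup>+\<omega>. indicator B (U \<omega>) * indicator (C -` D \<inter> space M) \<omega> \<partial>M)"
        by (simp add: emeasure_distr emeasure_density)
      also have "\<dots> = (\<integral>\<^sup>+\<omega>. indicator {\<omega> \<in> space M. U \<omega> \<in> B \<and> C \<omega> \<in> D} \<omega> \<partial>M)"
        by (intro nn_integral_cong) (auto split: split_indicator)
      also have "\<dots> = emeasure M {\<omega> \<in> space M. U \<omega> \<in> B \<and> C \<omega> \<in> D}"
        by (rule nn_integral_indicator) measurable
      finally show "emeasure (distr (density M (\<lambda>\<omega>. indicator B (U \<omega>))) borel C) D =
          emeasure (density (distr M borel C) (\<lambda>x. emeasure (\<kappa> x) B)) D"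
        by (simp add: \<kappa>_eq emeasure_density)
    qed simp
    then have "integral\<^sup>N (distr (density M (\<lambda>\<omega>. indicator B (U \<omega>))) borel C) g =
        integral\<^sup>N (density (distr M borel C) (\<lambda>x. emeasure (\<kappa> x) B)) g" by simp
    then show ?thesis by (simp add: nn_integral_distr nn_integral_density)
  qed
  have "distr (density M (\<lambda>\<omega>. g (C \<omega>))) borel U = density (distr M borel C) g \<bind> \<kappa>"
  proof (rule measure_eqI)
    show sets: "sets (distr (density M (\<lambda>\<omega>. g (C \<omega>))) borel U) = sets (density (distr M borel C) g \<bind> \<kappa>)"
      by (subst sets_bind[where N = borel]) (auto intro!: sets_kernel[OF \<kappa>_meas])
    fix B assume "B \<in> sets (distr (density M (\<lambda>\<omega>. g (C \<omega>))) borel U)"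
    then have [measurable]: "B \<in> sets borel" by simp
    have "emeasure (distr (density M (\<lambda>\<omega>. g (C \<omega>))) borel U) B = (\<integral>\<^sup>+\<omega>. indicator B (U \<omega>) * g (C \<omega>) \<partial>M)"
      by (subst emeasure_distr)
         (auto simp: emeasure_density mult.commute intro!: nn_integral_cong split: split_indicator)
    also have "\<dots> = emeasure (density (distr M borel C) g \<bind> \<kappa>) B"
      using B[of B] by (subst emeasure_bind[where N = borel])
        (auto simp: nn_integral_distr nn_integral_density mult.commute)
    finally show "emeasure (distr (density M (\<lambda>\<omega>. g (C \<omega>))) borel U) B =
        emeasure (density (distr M borel C) g \<bind> \<kappa>) B" .
  qed
  then have "integral\<^sup>N (distr (density M (\<lambda>\<omega>. g (C \<omega>))) borel U) \<phi> =
      integral\<^sup>N (density (distr M borel C) g \<bind> \<kappa>) \<phi>" by simp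
  moreover have "integral\<^sup>N (density (distr M borel C) g \<bind> \<kappa>) \<phi> =
      (\<integral>\<^sup>+x. (\<integral>\<^sup>+y. \<phi> y \<partial>\<kappa> x) \<partial>density (distr M borel C) g)"
    by (rule nn_integral_bind[where B = borel]) (auto cong: measurable_cong_sets)
  ultimately show ?thesis by (simp add: nn_integral_distr nn_integral_density mult.commute)
qed

lemma pos_regression_dep_imp_stoch_increasing:
  assumes M: "prob_space M" and UC[measurable]: "U \<in> borel_measurable M" "C \<in> borel_measurable M"
    and supp: "is_support M U SU" "is_support M C SC"
    and dep: "pos_regression_dep M SU SC U C"
  shows "stoch_increasing M SU U C"
  unfolding stoch_increasing_def
proof (intro ballI impI)
  interpret prob_space M by fact
  obtain \<kappa> where \<kappa>: "is_cond_distr M U C \<kappa>"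
    and \<kappa>_mono: "\<And>u. u \<in> SU \<Longrightarrow> mono_on SC (\<lambda>c. measure (\<kappa> c) {u..})"
    using dep by (auto simp: pos_regression_dep_def)
  have \<kappa>_meas[measurable]: "\<kappa> \<in> borel \<rightarrow>\<^sub>M subprob_algebra borel"
    and \<kappa>_prob: "prob_space (\<kappa> c)" "sets (\<kappa> c) = sets borel" for c
    using \<kappa> measurable_space[of \<kappa> borel "prob_algebra borel" c]
    by (auto simp: is_cond_distr_def space_prob_algebra intro: measurable_prob_algebraD)
  have SU[measurable]: "SU \<in> sets borel" and U_SU: "AE \<omega> in M. U \<omega> \<in> SU" and C_SC: "AE \<omega> in M. C \<omega> \<in> SC"
    using supp by (auto simp: is_support_def)
  \<comment> \<open>A version of the kernel may charge the complement of \<open>SU\<close> at some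
    \<open>c\<close>, and nothing is known about tails or \<open>\<phi>\<close> there. Such
    \<open>c\<close> form a null set for \<open>C\<close>, since the average of these masses is the
    probability that \<open>U\<close> leaves \<open>SU\<close>; they are dropped from the carrying
    set below.\<close>
  have "(\<integral>\<^sup>+\<omega>. emeasure (\<kappa> (C \<omega>)) (- SU) \<partial>M) = (\<integral>\<^sup>+\<omega>. indicator (- SU) (U \<omega>) \<partial>M)"
    using nn_integral_cond_distr[OF UC \<kappa>, of "indicator (- SU)" "\<lambda>_. 1"] \<kappa>_prob by simp
  also have "\<dots> = 0" using U_SU by (subst nn_integral_0_iff_AE) (auto split: split_indicator)
  finally have "AE \<omega> in M. emeasure (\<kappa> (C \<omega>)) (- SU) = 0"
    by (subst (asm) nn_integral_0_iff_AE) auto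
  then have \<kappa>_SU: "AE \<omega> in M. measure (\<kappa> (C \<omega>)) SU = 1"
  proof eventually_elim
    case (elim \<omega>)
    interpret K: prob_space "\<kappa> (C \<omega>)" by (rule \<kappa>_prob)
    have "space (\<kappa> (C \<omega>)) = UNIV" using sets_eq_imp_space_eq[OF \<kappa>_prob(2)] by simp
    then have "measure (\<kappa> (C \<omega>)) (- SU) = 1 - measure (\<kappa> (C \<omega>)) SU"
      using K.prob_compl[of SU] \<kappa>_prob(2) by (simp add: Compl_eq_Diff_UNIV)
    with elim show ?case by (simp add: measure_def)
  qed
  fix \<phi> :: "real \<Rightarrow> real" assume \<phi>[measurable]: "\<phi> \<in> borel_measurable borel"
    and \<phi>_mono: "mono_on SU \<phi>" and \<phi>01: "\<forall>x. 0 \<le> \<phi> x \<and> \<phi> x \<le> 1"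
  define \<psi> where "\<psi> c = (\<integral>\<^sup>+x. ennreal (\<phi> x) \<partial>\<kappa> c)" for c
  have \<psi>_top: "\<psi> c < top" for c
  proof -
    interpret K: prob_space "\<kappa> c" by (rule \<kappa>_prob)
    have "\<psi> c \<le> (\<integral>\<^sup>+x. 1 \<partial>\<kappa> c)" unfolding \<psi>_def using \<phi>01 by (intro nn_integral_mono) simp
    also have "\<dots> < top" by (simp add: K.emeasure_space_1)
    finally show ?thesis .
  qed
  show "\<exists>\<psi> T. mono_on T \<psi> \<and> (AE \<omega> in M. C \<omega> \<in> T) \<and>
     (AE \<omega> in M. real_cond_exp M (sigma_gen M C) (\<lambda>\<omega>. \<phi> (U \<omega>)) \<omega> = \<psi> (C \<omega>))"
  proof (intro exI conjI)
    show "AE \<omega> in M. C \<omega> \<in> {c \<in> SC. measure (\<kappa> c) SU = 1}" using C_SC \<kappa>_SU by auto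
    show "mono_on {c \<in> SC. measure (\<kappa> c) SU = 1} (\<lambda>c. enn2real (\<psi> c))"
    proof (rule mono_onI)
      fix c c' assume c: "c \<in> {c \<in> SC. measure (\<kappa> c) SU = 1}" "c' \<in> {c \<in> SC. measure (\<kappa> c) SU = 1}" "c \<le> c'"
      have "\<psi> c \<le> \<psi> c'"
        unfolding \<psi>_def
      proof (rule stochastic_dominance_integral[where S = SU])
        show "measure (\<kappa> c) {u..} \<le> measure (\<kappa> c') {u..}" if "u \<in> SU" for u
          using \<kappa>_mono[OF that] c by (auto simp: mono_on_def)
      qed (use c \<kappa>_prob \<phi>_mono \<phi>01 in auto)
      then show "enn2real (\<psi> c) \<le> enn2real (\<psi> c')" using \<psi>_top by (intro enn2real_mono)
    qed
    show "AE \<omega> in M. real_cond_exp M (sigma_gen M C) (\<lambda>\<omega>. \<phi> (U \<omega>)) \<omega> = enn2real (\<psi> (C \<omega>))"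
      using nn_integral_cond_distr[OF UC \<kappa>, of "\<lambda>x. ennreal (\<phi> x)"] \<phi>01
      by (intro real_cond_exp_sigma_genI M) (auto simp: \<psi>_def)
  qed
qed

section \<open>Likelihood ratios and Bayes' formula\<close>

text \<open>Posterior means of \<open>\<phi>\<close> under the prior \<open>\<mu>\<close> are
  compared, cross-multiplied so that normalisers may vanish. The ratio of \<open>f u c'\<close> to
  \<open>f u c\<close> increases with \<open>u\<close>, so the difference of the normalised
  likelihoods crosses zero once and has integral zero.\<close>

lemma likelihood_ratio_mono:
  fixes f :: "real \<Rightarrow> real \<Rightarrow> real" and \<phi> :: "real \<Rightarrow> real"
  assumes \<mu>: "prob_space \<mu>" "sets \<mu> = sets borel" and S: "AE u in \<mu>. u \<in> S"
    and f: "\<And>u. 0 \<le> f u c" "\<And>u. 0 \<le> f u c'"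
    and int: "integrable \<mu> (\<lambda>u. f u c)" "integrable \<mu> (\<lambda>u. f u c')"
    and \<phi>: "\<phi> \<in> borel_measurable borel" and \<phi>_mono: "mono_on S \<phi>" and \<phi>01: "\<And>x. 0 \<le> \<phi> x \<and> \<phi> x \<le> 1"
    and lr: "\<And>u v. u \<in> S \<Longrightarrow> v \<in> S \<Longrightarrow> u < v \<Longrightarrow> f v c * f u c' \<le> f v c' * f u c"
  shows "(\<integral>u. f u c * \<phi> u \<partial>\<mu>) * (\<integral>u. f u c' \<partial>\<mu>) \<le> (\<integral>u. f u c' * \<phi> u \<partial>\<mu>) * (\<integral>u. f u c \<partial>\<mu>)"
proof -
  interpret prob_space \<mu> by fact
  have [measurable]: "\<phi> \<in> borel_measurable \<mu>" using \<phi> \<mu>(2) by (simp cong: measurable_cong_sets)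
  define n where "n = (\<integral>u. f u c \<partial>\<mu>)"
  define n' where "n' = (\<integral>u. f u c' \<partial>\<mu>)"
  \<comment> \<open>The factors \<open>n\<close> and \<open>n'\<close> are swapped between the two
    likelihoods precisely to make the integral of \<open>d\<close> vanish.\<close>
  define d where "d u = f u c' * n - f u c * n'" for u
  define s where "s = threshold \<phi> 1 {u \<in> S. d u < 0}"
  have n: "0 \<le> n" "0 \<le> n'" unfolding n_def n'_def using f by auto
  have cross: "0 \<le> d v" if uv: "u \<in> S" "v \<in> S" "u < v" and du: "0 < d u" for u v
  \<comment> \<open>If \<open>f u c = 0\<close>, the likelihood ratio is infinite at
    \<open>u\<close>, and the product inequality forces \<open>f v c = 0\<close> as well.\<close>
  proof (cases "f u c = 0")
    case True
    have "0 < f u c' * n" using du True by (simp add: d_def)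
    then have "0 < f u c'" using f(2)[of u] by (cases "f u c' = 0") auto
    moreover have "f v c * f u c' \<le> 0" using lr[OF uv] True by simp
    ultimately have "f v c = 0" using f(1)[of v] by (simp add: mult_le_0_iff)
    then show ?thesis using f n by (simp add: d_def)
  next
    case False
    then have pos: "0 < f u c" using f(1)[of u] by simp
    have "(f v c * n') * f u c = f v c * (f u c * n')" by simp
    also have "\<dots> \<le> f v c * (f u c' * n)" using du f by (intro mult_left_mono) (auto simp: d_def)
    also have "\<dots> = (f v c * f u c') * n" by simp
    also have "\<dots> \<le> (f v c' * f u c) * n" using lr[OF uv] n by (intro mult_right_mono)
    also have "\<dots> = (f v c' * n) * f u c" by simp
    finally show ?thesis using pos by (simp add: d_def)
  qed
  have \<phi>b: "integrable \<mu> (\<lambda>u. h u * \<phi> u)" if "integrable \<mu> h" for h :: "real \<Rightarrow> real"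
    using that by (rule integrable_mult_bounded[where B = 1]) (use \<phi>01 in auto)
  have int_d: "integrable \<mu> d" unfolding d_def using int by auto
  have d0: "(\<integral>u. d u \<partial>\<mu>) = 0" unfolding d_def using int by (simp add: n_def n'_def)
  have "AE u in \<mu>. 0 \<le> d u * (\<phi> u - s)"
    using S
  proof eventually_elim
    case (elim u)
    show ?case unfolding s_def
      by (rule single_crossing_threshold[OF \<phi>_mono _ _ cross elim]) (use \<phi>01 in auto)
  qed
  then have "0 \<le> (\<integral>u. d u * (\<phi> u - s) \<partial>\<mu>)" by (rule integral_nonneg_AE)
  also have "\<dots> = (\<integral>u. d u * \<phi> u \<partial>\<mu>) - s * (\<integral>u. d u \<partial>\<mu>)"
    using int_d \<phi>b[OF int_d] by (simp add: right_diff_distrib mult.commute)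
  also have "\<dots> = (\<integral>u. n * (f u c' * \<phi> u) - n' * (f u c * \<phi> u) \<partial>\<mu>)"
    unfolding d0 by (simp add: d_def algebra_simps)
  also have "\<dots> = n * (\<integral>u. f u c' * \<phi> u \<partial>\<mu>) - n' * (\<integral>u. f u c * \<phi> u \<partial>\<mu>)"
    using \<phi>b[OF int(1)] \<phi>b[OF int(2)] by simp
  finally show ?thesis by (simp add: n_def n'_def mult.commute)
qed

text \<open>Bayes' formula expresses the conditional expectation of
  \<open>\<phi> (U \<omega>)\<close> given \<open>C\<close> as a quotient of two integrals over the
  law of \<open>U\<close>, and likelihood ratio monotonicity makes this quotient increase. The
  dominating measure \<open>\<nu>\<close> stays abstract in order to serve densities and mass
  functions alike.\<close>

lemma likelihood_ratio_dep_imp_stoch_increasing: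
  fixes f :: "real \<Rightarrow> real \<Rightarrow> real"
  assumes M: "prob_space M" and UC[measurable]: "U \<in> borel_measurable M" "C \<in> borel_measurable M"
    and S[measurable]: "S \<in> sets borel" and U_S: "AE \<omega> in M. U \<omega> \<in> S" and C_T: "AE \<omega> in M. C \<omega> \<in> T"
    and \<kappa>: "is_cond_distr M C U \<kappa>"
    and \<nu>: "sigma_finite_measure \<nu>" and sets_\<nu>[measurable_cong]: "sets \<nu> = sets borel"
    and f: "(\<lambda>(u, c). f u c) \<in> borel_measurable (borel \<Otimes>\<^sub>M borel)"
    and f_nonneg: "\<And>u c. 0 \<le> f u c"
    and \<kappa>_eq: "\<And>u. u \<in> S \<Longrightarrow> \<kappa> u = density \<nu> (\<lambda>c. ennreal (f u c))"
    and lr: "\<And>u v c c'. u \<in> S \<Longrightarrow> v \<in> S \<Longrightarrow> c \<in> T \<Longrightarrow> c' \<in> T \<Longrightarrow> u < v \<Longrightarrow> c < c' \<Longrightarrow>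
      f v c * f u c' \<le> f v c' * f u c"
  shows "stoch_increasing M S U C"
  unfolding stoch_increasing_def
proof (intro ballI impI)
  interpret prob_space M by fact
  interpret \<nu>: sigma_finite_measure \<nu> by fact
  define \<mu> where "\<mu> = distr M borel U"
  interpret \<mu>: prob_space \<mu> unfolding \<mu>_def by (rule prob_space_distr) simp
  interpret pair_sigma_finite \<mu> \<nu> ..
  have sets_\<mu>[measurable_cong]: "sets \<mu> = sets borel" by (simp add: \<mu>_def)
  have \<mu>_S: "AE u in \<mu>. u \<in> S"
    unfolding \<mu>_def using U_S by (subst AE_distr_iff) auto
  have f_meas[measurable (raw)]: "(\<lambda>x. f (a x) (b x)) \<in> borel_measurable K"
    if "a \<in> borel_measurable K" "b \<in> borel_measurable K" for a b and K :: "'k measure"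
    using measurable_compose[OF measurable_Pair[OF that] f] by simp
  \<comment> \<open>Numerator of Bayes' formula: the density with respect to \<open>\<nu>\<close> of
    the law of \<open>C\<close> when outcomes are weighted by \<open>\<phi> (U \<omega>)\<close>.
    For the constant 1 it becomes the density \<open>N\<close> of \<open>C\<close>.\<close>
  define I where "I \<phi> c = (\<integral>\<^sup>+u. ennreal (f u c) * ennreal (\<phi> u) \<partial>\<mu>)" for \<phi> :: "real \<Rightarrow> real" and c
  have I_meas[measurable]: "I \<phi> \<in> borel_measurable borel" if [measurable]: "\<phi> \<in> borel_measurable borel" for \<phi>
    unfolding I_def by measurable
  have joint: "(\<integral>\<^sup>+\<omega>. ennreal (\<phi> (U \<omega>)) * g (C \<omega>) \<partial>M) = (\<integral>\<^sup>+c. I \<phi> c * g c \<partial>\<nu>)"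
    if [measurable]: "\<phi> \<in> borel_measurable borel" "g \<in> borel_measurable borel" for \<phi> and g :: "real \<Rightarrow> ennreal"
  proof -
    have density_eq: "(\<integral>\<^sup>+c. g c \<partial>density \<nu> (\<lambda>c. ennreal (f u c))) = (\<integral>\<^sup>+c. ennreal (f u c) * g c \<partial>\<nu>)" for u
      by (rule nn_integral_density) measurable
    have "(\<integral>\<^sup>+\<omega>. ennreal (\<phi> (U \<omega>)) * g (C \<omega>) \<partial>M) = (\<integral>\<^sup>+\<omega>. (\<integral>\<^sup>+c. g c \<partial>\<kappa> (U \<omega>)) * ennreal (\<phi> (U \<omega>)) \<partial>M)"
      unfolding nn_integral_cond_distr[OF UC(2,1) \<kappa> that(2) measurable_compose[OF that(1) measurable_ennreal], symmetric]
      by (simp only: mult.commute)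
    also have "\<dots> = (\<integral>\<^sup>+\<omega>. (\<integral>\<^sup>+c. ennreal (f (U \<omega>) c) * g c \<partial>\<nu>) * ennreal (\<phi> (U \<omega>)) \<partial>M)"
      by (rule nn_integral_cong_AE, use U_S in eventually_elim)
         (simp add: \<kappa>_eq density_eq)
    also have "\<dots> = (\<integral>\<^sup>+u. (\<integral>\<^sup>+c. ennreal (f u c) * g c \<partial>\<nu>) * ennreal (\<phi> u) \<partial>\<mu>)"
      unfolding \<mu>_def by (subst nn_integral_distr) measurable
    also have "\<dots> = (\<integral>\<^sup>+u. (\<integral>\<^sup>+c. ennreal (f u c) * g c * ennreal (\<phi> u) \<partial>\<nu>) \<partial>\<mu>)"
      by (intro nn_integral_cong nn_integral_multc[symmetric]) measurable
    also have "\<dots> = (\<integral>\<^sup>+c. (\<integral>\<^sup>+u. ennreal (f u c) * g c * ennreal (\<phi> u) \<partial>\<mu>) \<partial>\<nu>)"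
      by (rule Fubini'[symmetric]) measurable
    also have "\<dots> = (\<integral>\<^sup>+c. (\<integral>\<^sup>+u. ennreal (f u c) * ennreal (\<phi> u) * g c \<partial>\<mu>) \<partial>\<nu>)"
      by (simp add: ac_simps)
    also have "\<dots> = (\<integral>\<^sup>+c. I \<phi> c * g c \<partial>\<nu>)"
      unfolding I_def by (intro nn_integral_cong nn_integral_multc) measurable
    finally show ?thesis .
  qed
  define N where "N = I (\<lambda>_. 1)"
  have N_meas[measurable]: "N \<in> borel_measurable borel" unfolding N_def by measurable
  have joint1: "(\<integral>\<^sup>+\<omega>. g (C \<omega>) \<partial>M) = (\<integral>\<^sup>+c. N c * g c \<partial>\<nu>)"
    if "g \<in> borel_measurable borel" for g :: "real \<Rightarrow> ennreal"
    using joint[of "\<lambda>_. 1" g] that by (simp add: N_def)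
  have "(\<integral>\<^sup>+c. N c \<partial>\<nu>) = 1" using joint1[of "\<lambda>_. 1"] by (simp add: emeasure_space_1)
  then have N_fin: "AE c in \<nu>. N c \<noteq> \<infinity>" by (intro nn_integral_PInf_AE) auto
  \<comment> \<open>The law of \<open>C\<close> has density \<open>N\<close>, so it ignores the
    zeros of \<open>N\<close> as well as the \<open>\<nu>\<close>-null set where \<open>N\<close> is
    infinite. Outside these the quotient is a genuine posterior mean.\<close>
  have C_N: "AE \<omega> in M. N (C \<omega>) \<noteq> 0 \<and> N (C \<omega>) \<noteq> \<infinity>"
  proof -
    have "(\<integral>\<^sup>+\<omega>. indicator {c. N c = 0 \<or> N c = \<infinity>} (C \<omega>) \<partial>M) =
        (\<integral>\<^sup>+c. N c * indicator {c. N c = 0 \<or> N c = \<infinity>} c \<partial>\<nu>)" by (rule joint1) measurable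
    also have "\<dots> = 0"
      by (subst nn_integral_0_iff_AE) (use N_fin in \<open>auto split: split_indicator\<close>)
    finally have "AE \<omega> in M. indicator {c. N c = 0 \<or> N c = \<infinity>} (C \<omega>) = (0::ennreal)"
      by (subst (asm) nn_integral_0_iff_AE) auto
    then show ?thesis by eventually_elim (auto simp: indicator_def split: if_splits)
  qed
  fix \<phi> :: "real \<Rightarrow> real" assume \<phi>[measurable]: "\<phi> \<in> borel_measurable borel"
    and \<phi>_mono: "mono_on S \<phi>" and \<phi>01: "\<forall>x. 0 \<le> \<phi> x \<and> \<phi> x \<le> 1"
  have I_le: "I \<phi> c \<le> N c" for c
    unfolding N_def I_def using \<phi>01 by (intro nn_integral_mono mult_left_mono) auto
  define \<psi> where "\<psi> c = I \<phi> c / N c" for c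
  have [measurable]: "\<psi> \<in> borel_measurable borel" unfolding \<psi>_def by measurable
  show "\<exists>\<psi> T. mono_on T \<psi> \<and> (AE \<omega> in M. C \<omega> \<in> T) \<and>
     (AE \<omega> in M. real_cond_exp M (sigma_gen M C) (\<lambda>\<omega>. \<phi> (U \<omega>)) \<omega> = \<psi> (C \<omega>))"
  proof (intro exI conjI)
    show "AE \<omega> in M. C \<omega> \<in> {c \<in> T. N c \<noteq> 0 \<and> N c \<noteq> \<infinity>}" using C_T C_N by auto
    show "mono_on {c \<in> T. N c \<noteq> 0 \<and> N c \<noteq> \<infinity>} (\<lambda>c. enn2real (\<psi> c))"
    proof (rule mono_onI)
      fix c c' assume c: "c \<in> {c \<in> T. N c \<noteq> 0 \<and> N c \<noteq> \<infinity>}" "c' \<in> {c \<in> T. N c \<noteq> 0 \<and> N c \<noteq> \<infinity>}" "c \<le> c'"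
      have int: "integrable \<mu> (\<lambda>u. f u x)" if "N x \<noteq> \<infinity>" for x
        using that f_nonneg by (intro integrableI_nonneg) (auto simp: N_def I_def less_top)
      have N_eq: "N x = ennreal (\<integral>u. f u x \<partial>\<mu>)" if "N x \<noteq> \<infinity>" for x
        using int[OF that] f_nonneg by (simp add: N_def I_def nn_integral_eq_integral)
      have I_eq: "I \<phi> x = ennreal (\<integral>u. f u x * \<phi> u \<partial>\<mu>)" if "N x \<noteq> \<infinity>" for x
      proof -
        have "integrable \<mu> (\<lambda>u. f u x * \<phi> u)"
          by (rule integrable_mult_bounded[where B = 1, OF int[OF that]]) (use \<phi>01 in auto)
        then show ?thesis
          using \<phi>01 f_nonneg by (simp add: I_def ennreal_mult[symmetric] nn_integral_eq_integral)
      qed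
      have \<psi>_eq: "enn2real (\<psi> x) = (\<integral>u. f u x * \<phi> u \<partial>\<mu>) / (\<integral>u. f u x \<partial>\<mu>)"
        and pos: "0 < (\<integral>u. f u x \<partial>\<mu>)" if "N x \<noteq> \<infinity>" "N x \<noteq> 0" for x
      proof -
        show pos: "0 < (\<integral>u. f u x \<partial>\<mu>)" using that N_eq[of x] by (auto simp: ennreal_eq_0_iff)
        have "0 \<le> (\<integral>u. f u x * \<phi> u \<partial>\<mu>)" using f_nonneg \<phi>01 by simp
        then show "enn2real (\<psi> x) = (\<integral>u. f u x * \<phi> u \<partial>\<mu>) / (\<integral>u. f u x \<partial>\<mu>)"
          using pos unfolding \<psi>_def I_eq[OF that(1)] N_eq[OF that(1)] by (simp add: divide_ennreal)
      qed
      show "enn2real (\<psi> c) \<le> enn2real (\<psi> c')"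
      proof (cases "c = c'")
        case False
        then have "c < c'" using c by simp
        have "(\<integral>u. f u c * \<phi> u \<partial>\<mu>) * (\<integral>u. f u c' \<partial>\<mu>) \<le> (\<integral>u. f u c' * \<phi> u \<partial>\<mu>) * (\<integral>u. f u c \<partial>\<mu>)"
          by (rule likelihood_ratio_mono[where S = S, OF \<mu>.prob_space_axioms sets_\<mu>])
             (use c \<open>c < c'\<close> f_nonneg int lr \<phi>_mono \<phi>01 \<mu>_S in auto)
        then show ?thesis
          using c pos[of c] pos[of c'] by (simp add: \<psi>_eq divide_le_eq pos_le_divide_eq mult.commute)
      qed simp
    qed
    show "AE \<omega> in M. real_cond_exp M (sigma_gen M C) (\<lambda>\<omega>. \<phi> (U \<omega>)) \<omega> = enn2real (\<psi> (C \<omega>))"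
    proof (rule real_cond_exp_sigma_genI[where \<phi> = \<phi> and U = U])
      fix D :: "real set" assume [measurable]: "D \<in> sets borel"
      have "(\<integral>\<^sup>+\<omega>. ennreal (\<phi> (U \<omega>)) * indicator D (C \<omega>) \<partial>M) = (\<integral>\<^sup>+c. I \<phi> c * indicator D c \<partial>\<nu>)"
        by (rule joint) measurable
      also have "\<dots> = (\<integral>\<^sup>+c. N c * (\<psi> c * indicator D c) \<partial>\<nu>)"
      proof (rule nn_integral_cong_AE, use N_fin in eventually_elim)
        case (elim c)
        show ?case
        \<comment> \<open>Where the quotient degenerates, the bound
          \<open>I \<phi> c \<le> N c\<close> makes both sides vanish.\<close>
        proof (cases "N c = 0")
          case True
          then show ?thesis using I_le[of c] by simp
        next
          case False
          then have "N c * \<psi> c = I \<phi> c"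
            using elim by (simp add: \<psi>_def ennreal_times_divide ennreal_mult_divide_eq mult.commute[of "N c"])
          then show ?thesis by (simp add: mult.assoc[symmetric])
        qed
      qed
      also have "\<dots> = (\<integral>\<^sup>+\<omega>. \<psi> (C \<omega>) * indicator D (C \<omega>) \<partial>M)"
        by (rule joint1[symmetric]) measurable
      finally show "(\<integral>\<^sup>+\<omega>. ennreal (\<phi> (U \<omega>)) * indicator D (C \<omega>) \<partial>M) = (\<integral>\<^sup>+\<omega>. \<psi> (C \<omega>) * indicator D (C \<omega>) \<partial>M)" .
    qed (use M \<phi>01 in auto)
  qed
qed

text \<open>The two alternatives differ only in the dominating measure: Lebesgue measure, or
  counting measure on the countable set of atoms.\<close>

lemma cond_density_imp_stoch_increasing:
  fixes f :: "real \<Rightarrow> real \<Rightarrow> real"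
  assumes M: "prob_space M" and UC: "U \<in> borel_measurable M" "C \<in> borel_measurable M"
    and S[measurable]: "S \<in> sets borel" and U_S: "AE \<omega> in M. U \<omega> \<in> S" and C_T: "AE \<omega> in M. C \<omega> \<in> T"
    and \<kappa>: "is_cond_distr M C U \<kappa>"
    and f: "((\<lambda>(u, c). f u c) \<in> borel_measurable borel \<and>
          (\<forall>u \<in> S. (\<forall>c. 0 \<le> f u c) \<and> \<kappa> u = density lborel (\<lambda>c. ennreal (f u c)))) \<or>
         (\<exists>D. countable D \<and>
          (\<forall>u \<in> S. measure (\<kappa> u) D = 1 \<and> (\<forall>c. f u c = measure (\<kappa> u) {c})))"
    and lr: "\<forall>c \<in> T. \<forall>c' \<in> T. \<forall>u \<in> S. \<forall>u' \<in> S. c' > c \<longrightarrow> u' > u \<longrightarrow>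
             f u' c' * f u c \<ge> f u' c * f u c'"
  shows "stoch_increasing M S U C"
  using f
proof
  assume f: "(\<lambda>(u, c). f u c) \<in> borel_measurable borel \<and>
    (\<forall>u \<in> S. (\<forall>c. 0 \<le> f u c) \<and> \<kappa> u = density lborel (\<lambda>c. ennreal (f u c)))"
  \<comment> \<open>Sign and meaning of \<open>f\<close> are guaranteed only for \<open>u\<close> in
    \<open>S\<close>; outside, zero is substituted.\<close>
  define f' where "f' u c = (if u \<in> S then f u c else 0)" for u c
  show ?thesis
  proof (rule likelihood_ratio_dep_imp_stoch_increasing[OF M UC S U_S C_T \<kappa>])
    show "sigma_finite_measure (lborel :: real measure)" ..
    have [measurable]: "(\<lambda>z. case z of (u, c) \<Rightarrow> f u c) \<in> borel_measurable (borel \<Otimes>\<^sub>M borel)"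
      using f by (simp add: borel_prod)
    have "(\<lambda>z. if fst z \<in> S then case z of (u, c) \<Rightarrow> f u c else 0) \<in> borel_measurable (borel \<Otimes>\<^sub>M borel)"
      by measurable
    then show "(\<lambda>(u, c). f' u c) \<in> borel_measurable (borel \<Otimes>\<^sub>M borel)"
      by (simp add: f'_def split_beta')
    show "0 \<le> f' u c" for u c using f by (simp add: f'_def)
    show "\<kappa> u = density lborel (\<lambda>c. ennreal (f' u c))" if "u \<in> S" for u
      using f that by (simp add: f'_def)
    show "f' v c * f' u c' \<le> f' v c' * f' u c"
      if "u \<in> S" "v \<in> S" "c \<in> T" "c' \<in> T" "u < v" "c < c'" for u v c c'
      using lr that by (simp add: f'_def)
  qed simp
next
  assume "\<exists>D. countable D \<and> (\<forall>u \<in> S. measure (\<kappa> u) D = 1 \<and> (\<forall>c. f u c = measure (\<kappa> u) {c}))"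
  then obtain D where D: "countable D" "\<And>u. u \<in> S \<Longrightarrow> measure (\<kappa> u) D = 1"
    and f: "\<And>u c. u \<in> S \<Longrightarrow> f u c = measure (\<kappa> u) {c}" by auto
  have D_borel[measurable]: "D \<in> sets borel" by (rule sets.countable[OF _ D(1)]) simp
  \<comment> \<open>Cutting to \<open>D\<close> leaves the mass function intact on \<open>S\<close>,
    where \<open>D\<close> has full mass, and makes joint measurability a matter of countably many
    atoms.\<close>
  define f' where "f' u c = (if u \<in> S \<and> c \<in> D then f u c else 0)" for u c
  \<comment> \<open>Counting measure on \<open>D\<close> lives on all subsets of \<open>D\<close>;
    the pushforward turns it into a measure on the Borel sets of the line.\<close>
  define \<nu> where "\<nu> = distr (count_space D) borel (\<lambda>c. c)"
  have sets_\<nu>: "sets \<nu> = sets borel" and space_\<nu>: "space \<nu> = UNIV" by (simp_all add: \<nu>_def)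
  show ?thesis
  proof (rule likelihood_ratio_dep_imp_stoch_increasing[where f = f' and T = "T \<inter> D", OF M UC S U_S _ \<kappa> _ sets_\<nu>])
    have \<kappa>_meas: "\<kappa> \<in> borel \<rightarrow>\<^sub>M subprob_algebra borel"
      and \<kappa>_prob: "prob_space (\<kappa> u)" "sets (\<kappa> u) = sets borel" for u
      using \<kappa> measurable_space[of \<kappa> borel "prob_algebra borel" u]
      by (auto simp: is_cond_distr_def space_prob_algebra intro: measurable_prob_algebraD)
    note [measurable] = \<kappa>_meas UC
    have \<kappa>_D: "AE x in \<kappa> u. x \<in> D" if "u \<in> S" for u
      using D(2)[OF that] \<kappa>_prob by (subst prob_space.prob_eq_1[symmetric]) auto
    have "(\<integral>\<^sup>+\<omega>. indicator (- D) (C \<omega>) \<partial>M) = (\<integral>\<^sup>+\<omega>. emeasure (\<kappa> (U \<omega>)) (- D) \<partial>M)"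
      using nn_integral_cond_distr[OF UC(2,1) \<kappa>, of "indicator (- D)" "\<lambda>_. 1"] \<kappa>_prob by simp
    also have "\<dots> = 0"
    proof (subst nn_integral_0_iff_AE)
      show "AE \<omega> in M. emeasure (\<kappa> (U \<omega>)) (- D) = 0"
        using U_S
      proof eventually_elim
        case (elim \<omega>)
        have "emeasure (\<kappa> (U \<omega>)) (- D) = emeasure (\<kappa> (U \<omega>)) {}"
          using \<kappa>_D[OF elim] \<kappa>_prob by (intro emeasure_eq_AE) auto
        then show ?case by simp
      qed
    qed measurable
    finally have "AE \<omega> in M. indicator (- D) (C \<omega>) = (0::ennreal)"
      by (subst (asm) nn_integral_0_iff_AE) auto
    then show "AE \<omega> in M. C \<omega> \<in> T \<inter> D"
      using C_T by eventually_elim (auto simp: indicator_def split: if_splits)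
    have emeasure_\<nu>: "emeasure \<nu> E = emeasure (count_space D) (E \<inter> D)" if "E \<in> sets borel" for E
      using that by (simp add: \<nu>_def emeasure_distr)
    show "sigma_finite_measure \<nu>"
    proof
      show "\<exists>F. countable F \<and> F \<subseteq> sets \<nu> \<and> \<Union> F = space \<nu> \<and> (\<forall>a\<in>F. emeasure \<nu> a \<noteq> \<infinity>)"
        by (rule exI[of _ "insert (- D) ((\<lambda>d. {d}) ` D)"])
           (use D(1) in \<open>auto simp: sets_\<nu> space_\<nu> emeasure_\<nu> Int_insert_left\<close>)
    qed
    have "(\<lambda>z. f' (fst z) (snd z)) \<in> borel_measurable (borel \<Otimes>\<^sub>M borel)"
    proof (subst borel_measurable_iff_greater, intro allI)
      fix t :: real
      show "{z \<in> space (borel \<Otimes>\<^sub>M borel). t < f' (fst z) (snd z)} \<in> sets (borel \<Otimes>\<^sub>M borel)"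
      proof (cases "t < 0")
        case True
        have "0 \<le> f' u c" for u c using f by (simp add: f'_def)
        with True have "t < f' u c" for u c by (rule order.strict_trans2)
        then show ?thesis by simp
      next
        case False
        \<comment> \<open>For a nonnegative level only atoms contribute, so the superlevel set is a
          countable union of measurable rectangles.\<close>
        then have "{z \<in> space (borel \<Otimes>\<^sub>M borel). t < f' (fst z) (snd z)} =
            (\<Union>d\<in>D. {u \<in> S. t < measure (\<kappa> u) {d}} \<times> {d})"
          using f by (auto simp: f'_def space_pair_measure split: if_splits)
        also have "\<dots> \<in> sets (borel \<Otimes>\<^sub>M borel)"
          using D(1) by (intro sets.countable_UN'' pair_measureI) auto
        finally show ?thesis .
      qed
    qed
    then show "(\<lambda>(u, c). f' u c) \<in> borel_measurable (borel \<Otimes>\<^sub>M borel)" by (simp add: split_beta')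
    show "0 \<le> f' u c" for u c using f by (simp add: f'_def)
    show "\<kappa> u = density \<nu> (\<lambda>c. ennreal (f' u c))" if u: "u \<in> S" for u
    proof (rule measure_eqI)
      interpret K: prob_space "\<kappa> u" by (rule \<kappa>_prob)
      fix E assume "E \<in> sets (\<kappa> u)"
      then have [measurable]: "E \<in> sets borel" by (simp add: \<kappa>_prob)
      have f'_meas: "(\<lambda>c. ennreal (f' u c)) \<in> borel_measurable borel"
        using measurable_compose[OF measurable_Pair1'[of u borel borel] \<open>(\<lambda>(u, c). f' u c) \<in> _\<close>] by simp
      have "emeasure (\<kappa> u) E = emeasure (\<kappa> u) (E \<inter> D)"
        using \<kappa>_D[OF u] \<kappa>_prob by (intro emeasure_eq_AE) auto
      also have "\<dots> = (\<integral>\<^sup>+c. emeasure (\<kappa> u) {c} \<partial>count_space (E \<inter> D))"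
        using D(1) by (intro emeasure_countable_singleton) (auto simp: \<kappa>_prob)
      also have "\<dots> = (\<integral>\<^sup>+c. ennreal (f' u c) * indicator E c \<partial>count_space D)"
        using u f by (subst (1 2) nn_integral_count_space_indicator)
          (auto simp: f'_def K.emeasure_eq_measure intro!: nn_integral_cong split: split_indicator)
      also have "\<dots> = emeasure (density \<nu> (\<lambda>c. ennreal (f' u c))) E"
      proof -
        have "emeasure (density \<nu> (\<lambda>c. ennreal (f' u c))) E = (\<integral>\<^sup>+c\<in>E. ennreal (f' u c) \<partial>\<nu>)"
          using f'_meas sets_\<nu> by (intro emeasure_density) (simp_all cong: measurable_cong_sets)
        also have "\<dots> = (\<integral>\<^sup>+c. ennreal (f' u c) * indicator E c \<partial>count_space D)"
          unfolding \<nu>_def using f'_meas by (intro nn_integral_distr) simp_all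
        finally show ?thesis by simp
      qed
      finally show "emeasure (\<kappa> u) E = emeasure (density \<nu> (\<lambda>c. ennreal (f' u c))) E" .
    qed (simp add: \<kappa>_prob sets_\<nu>)
    show "f' v c * f' u c' \<le> f' v c' * f' u c"
      if "u \<in> S" "v \<in> S" "c \<in> T \<inter> D" "c' \<in> T \<inter> D" "u < v" "c < c'" for u v c c'
      using lr that by (simp add: f'_def)
  qed
qed

section \<open>Conditioning on the treatment\<close>

lemma given_eq_density:
  assumes "prob_space M" and [measurable]: "A \<in> borel_measurable M"
    and q: "measure M {\<omega> \<in> space M. A \<omega> = a} \<noteq> 0"
  shows "given M A a = density M (\<lambda>\<omega>. ennreal (indicator {a} (A \<omega>) / measure M {\<omega> \<in> space M. A \<omega> = a}))"
proof -
  interpret prob_space M by fact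
  let ?q = "measure M {\<omega> \<in> space M. A \<omega> = a}"
  have "0 < ?q" using q by (simp add: zero_less_measure_iff)
  then show ?thesis
    unfolding given_def uniform_measure_def emeasure_eq_measure
    by (intro density_cong AE_I2)
       (auto simp: divide_ennreal[symmetric] ennreal_divide_eq_top_iff split: split_indicator)
qed

lemma
  fixes M :: "'w measure" and f :: "'w \<Rightarrow> real"
  assumes M: "prob_space M" and A[measurable]: "A \<in> borel_measurable M"
    and q: "measure M {\<omega> \<in> space M. A \<omega> = a} \<noteq> 0"
  shows prob_space_given: "prob_space (given M A a)"
    and sets_given[simp]: "sets (given M A a) = sets M"
    and space_given[simp]: "space (given M A a) = space M"
    and AE_given_iff: "(AE \<omega> in given M A a. P \<omega>) \<longleftrightarrow> (AE \<omega> in M. A \<omega> = a \<longrightarrow> P \<omega>)"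
    and integrable_given_iff: "f \<in> borel_measurable M \<Longrightarrow>
      integrable (given M A a) f \<longleftrightarrow> integrable M (\<lambda>\<omega>. indicator {a} (A \<omega>) * f \<omega>)"
    and integral_given: "f \<in> borel_measurable M \<Longrightarrow>
      (\<integral>\<omega>. f \<omega> \<partial>given M A a) = (\<integral>\<omega>. indicator {a} (A \<omega>) * f \<omega> \<partial>M) / measure M {\<omega> \<in> space M. A \<omega> = a}"
proof -
  interpret prob_space M by fact
  let ?q = "measure M {\<omega> \<in> space M. A \<omega> = a}"
  have q0: "0 < ?q" using q by (simp add: zero_less_measure_iff)
  note eq = given_eq_density[OF M A q]
  show "prob_space (given M A a)"
    unfolding given_def by (rule prob_space_uniform_measure) (use q in \<open>auto simp: emeasure_eq_measure\<close>)
  show "sets (given M A a) = sets M" "space (given M A a) = space M" by (simp_all add: given_def)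
  show "(AE \<omega> in given M A a. P \<omega>) \<longleftrightarrow> (AE \<omega> in M. A \<omega> = a \<longrightarrow> P \<omega>)"
    unfolding eq using q0 by (subst AE_density) (auto split: split_indicator)
  { fix f :: "'w \<Rightarrow> real" assume [measurable]: "f \<in> borel_measurable M"
    have "integrable (given M A a) f \<longleftrightarrow> integrable M (\<lambda>\<omega>. (indicator {a} (A \<omega>) / ?q) *\<^sub>R f \<omega>)"
      unfolding eq using q0 by (intro integrable_density) auto
    also have "\<dots> \<longleftrightarrow> integrable M (\<lambda>\<omega>. inverse ?q * (indicator {a} (A \<omega>) * f \<omega>))"
      by (simp add: divide_inverse mult_ac)
    also have "\<dots> \<longleftrightarrow> integrable M (\<lambda>\<omega>. indicator {a} (A \<omega>) * f \<omega>)"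
      using q by (subst integrable_mult_left_iff) simp
    finally show "integrable (given M A a) f \<longleftrightarrow> integrable M (\<lambda>\<omega>. indicator {a} (A \<omega>) * f \<omega>)" .
    have "(\<integral>\<omega>. f \<omega> \<partial>given M A a) = (\<integral>\<omega>. (indicator {a} (A \<omega>) / ?q) *\<^sub>R f \<omega> \<partial>M)"
      unfolding eq using q0 by (intro integral_density) auto
    then show "(\<integral>\<omega>. f \<omega> \<partial>given M A a) = (\<integral>\<omega>. indicator {a} (A \<omega>) * f \<omega> \<partial>M) / ?q" by simp }
qed

lemma borel_measurable_fst: "fst \<in> borel_measurable (borel :: ('a::second_countable_topology \<times> 'b::second_countable_topology) measure)"
  unfolding borel_prod[symmetric] by simp

text \<open>Given \<open>U\<close>, the treatment says nothing about \<open>C\<close>, so the kernel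
  of \<open>C\<close> given \<open>U\<close> survives conditioning on \<open>A = a\<close>. This
  carries likelihood ratio dependence from \<open>M\<close> to each arm.\<close>

lemma is_cond_distr_given:
  fixes Y :: "'w \<Rightarrow> real" and w :: "real \<Rightarrow> real"
  assumes M: "prob_space M" and meas[measurable]: "U \<in> borel_measurable M" "C \<in> borel_measurable M"
      "A \<in> borel_measurable M" "Y \<in> borel_measurable M"
    and q: "measure M {\<omega> \<in> space M. A \<omega> = a} \<noteq> 0"
    and w: "is_cond_exp M (\<lambda>\<omega>. indicator {a} (A \<omega>)) U w" "\<And>u. 0 \<le> w u \<and> w u \<le> 1"
    and nondiff: "cond_indep M C (\<lambda>\<omega>. (A \<omega>, Y \<omega>)) U"
    and \<kappa>: "is_cond_distr M C U \<kappa>"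
  shows "is_cond_distr (given M A a) C U \<kappa>"
  unfolding is_cond_distr_def
proof (intro conjI ballI)
  interpret prob_space M by fact
  let ?N = "given M A a" and ?I = "\<lambda>\<omega>. indicator {a} (A \<omega>) :: real"
  let ?q = "measure M {\<omega> \<in> space M. A \<omega> = a}"
  interpret N: prob_space ?N by (rule prob_space_given) fact+
  interpret F: sigma_finite_subalgebra M "sigma_gen M U"
    by (rule sigma_finite_subalgebra_sigma_gen) fact+
  have [measurable_cong]: "sets ?N = sets M" and [simp]: "space ?N = space M"
    using sets_given space_given M meas q by auto
  have [measurable]: "w \<in> borel_measurable borel" and wE: "AE \<omega> in M. real_cond_exp M (sigma_gen M U) ?I \<omega> = w (U \<omega>)"
    using w(1) by (auto simp: is_cond_exp_def)
  show "\<kappa> \<in> borel \<rightarrow>\<^sub>M prob_algebra borel" using \<kappa> by (simp add: is_cond_distr_def)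
  then have [measurable]: "\<kappa> \<in> borel \<rightarrow>\<^sub>M subprob_algebra borel"
    and \<kappa>_prob: "prob_space (\<kappa> u)" "sets (\<kappa> u) = sets borel" for u
    using measurable_space[of \<kappa> borel "prob_algebra borel" u]
    by (auto simp: space_prob_algebra intro: measurable_prob_algebraD)
  fix B D :: "real set" assume [measurable]: "B \<in> sets borel" "D \<in> sets borel"
  define k where "k u = measure (\<kappa> u) B" for u
  have k_eq: "emeasure (\<kappa> u) B = ennreal (k u)" for u
    using \<kappa>_prob(1)[of u] by (simp add: k_def prob_space.finite_measure[THEN finite_measure.emeasure_eq_measure])
  have k: "0 \<le> k u" "k u \<le> 1" for u
    using \<kappa>_prob(1)[of u] by (auto simp: k_def prob_space.prob_le_1)
  have [measurable]: "k \<in> borel_measurable borel" unfolding k_def by measurable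
  have int: "integrable M f" if "f \<in> borel_measurable M" "\<And>\<omega>. \<bar>f \<omega>\<bar> \<le> 1" for f :: "'w \<Rightarrow> real"
    by (rule integrable_const_bound[of _ 1]) (use that in auto)
  have D_meas: "(\<lambda>\<omega>. indicator D (U \<omega>) :: real) \<in> borel_measurable (sigma_gen M U)"
    by (rule measurable_compose[OF measurable_sigma_gen]) simp
  have kD_meas: "(\<lambda>\<omega>. k (U \<omega>) * indicator D (U \<omega>)) \<in> borel_measurable (sigma_gen M U)"
    by (rule measurable_compose[OF measurable_sigma_gen, of "\<lambda>u. k u * indicator D u"]) simp
  have B_meas: "(\<lambda>\<omega>. indicator B (C \<omega>) :: real) \<in> borel_measurable (sigma_gen M C)"
    by (rule measurable_compose[OF measurable_sigma_gen]) simp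
  have AY: "(\<lambda>\<omega>. (A \<omega>, Y \<omega>)) \<in> borel_measurable M" unfolding borel_prod[symmetric] by measurable
  have I_fst: "(\<lambda>z. indicator {a} (fst z) :: real) \<in> borel_measurable (borel :: (real \<times> real) measure)"
    by (rule measurable_compose[OF borel_measurable_fst]) simp
  \<comment> \<open>Nondifferentiality replaces the treatment indicator by \<open>w\<close>. What
    remains involves \<open>U\<close> and \<open>C\<close> only, so the kernel applies under
    \<open>M\<close>.\<close>
  have "(\<integral>\<omega>. ?I \<omega> * indicator D (U \<omega>) * indicator B (C \<omega>) \<partial>M) = (\<integral>\<omega>. w (U \<omega>) * indicator D (U \<omega>) * indicator B (C \<omega>) \<partial>M)"
    using cond_indep_integral_cond_exp(2)[where \<phi> = "\<lambda>z. indicator {a} (fst z)" and X = "\<lambda>\<omega>. (A \<omega>, Y \<omega>)"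
      and k = "\<lambda>\<omega>. indicator D (U \<omega>)" and e = "\<lambda>\<omega>. w (U \<omega>)" and B = 1,
      OF M AY meas(2,1) nondiff I_fst _ D_meas _ B_meas] wE
    by (auto simp: int split: split_indicator)
  also have "\<dots> = enn2real (\<integral>\<^sup>+\<omega>. indicator B (C \<omega>) * ennreal (w (U \<omega>) * indicator D (U \<omega>)) \<partial>M)"
    using w by (subst integral_eq_nn_integral)
      (auto intro!: arg_cong[where f = enn2real] nn_integral_cong split: split_indicator)
  also have "\<dots> = enn2real (\<integral>\<^sup>+\<omega>. emeasure (\<kappa> (U \<omega>)) B * ennreal (w (U \<omega>) * indicator D (U \<omega>)) \<partial>M)"
    using nn_integral_cond_distr[OF meas(2,1) \<kappa>, of "indicator B" "\<lambda>u. ennreal (w u * indicator D u)"]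
    by (simp add: \<kappa>_prob)
  also have "\<dots> = (\<integral>\<omega>. (k (U \<omega>) * indicator D (U \<omega>)) * w (U \<omega>) \<partial>M)"
    using w k by (subst integral_eq_nn_integral)
      (auto simp: k_eq ennreal_mult intro!: arg_cong[where f = enn2real] nn_integral_cong split: split_indicator)
  \<comment> \<open>The kernel has removed \<open>C\<close>, so \<open>w\<close> can be turned back
    into the treatment indicator.\<close>
  also have "\<dots> = (\<integral>\<omega>. (k (U \<omega>) * indicator D (U \<omega>)) * real_cond_exp M (sigma_gen M U) ?I \<omega> \<partial>M)"
    by (rule integral_cong_AE) (use wE in auto)
  also have "\<dots> = (\<integral>\<omega>. (k (U \<omega>) * indicator D (U \<omega>)) * ?I \<omega> \<partial>M)"
    by (intro F.real_cond_exp_intg(2) int kD_meas) (use k in \<open>auto split: split_indicator\<close>)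
  finally have eq: "(\<integral>\<omega>. ?I \<omega> * (indicator D (U \<omega>) * indicator B (C \<omega>)) \<partial>M) =
      (\<integral>\<omega>. ?I \<omega> * (k (U \<omega>) * indicator D (U \<omega>)) \<partial>M)"
    by (simp add: mult_ac)
  have "emeasure ?N {\<omega> \<in> space ?N. C \<omega> \<in> B \<and> U \<omega> \<in> D} = ennreal (\<integral>\<omega>. indicat_real {\<omega> \<in> space M. C \<omega> \<in> B \<and> U \<omega> \<in> D} \<omega> \<partial>?N)"
    by (simp add: N.emeasure_eq_measure)
  also have "(\<integral>\<omega>. indicat_real {\<omega> \<in> space M. C \<omega> \<in> B \<and> U \<omega> \<in> D} \<omega> \<partial>?N) = (\<integral>\<omega>. indicator D (U \<omega>) * indicator B (C \<omega>) \<partial>?N)"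
    by (intro Bochner_Integration.integral_cong) (auto split: split_indicator)
  also have "\<dots> = (\<integral>\<omega>. k (U \<omega>) * indicator D (U \<omega>) \<partial>?N)"
    using eq by (simp add: integral_given[OF M meas(3) q])
  also have "ennreal \<dots> = (\<integral>\<^sup>+\<omega>. ennreal (k (U \<omega>) * indicator D (U \<omega>)) \<partial>?N)"
    by (intro nn_integral_eq_integral[symmetric] N.integrable_const_bound[of _ 1])
       (use k in \<open>auto split: split_indicator\<close>)
  also have "\<dots> = (\<integral>\<^sup>+x\<in>D. emeasure (\<kappa> x) B \<partial>distr ?N borel U)"
    by (subst nn_integral_distr) (auto simp: k_eq intro!: nn_integral_cong split: split_indicator)
  finally show "emeasure ?N {\<omega> \<in> space ?N. C \<omega> \<in> B \<and> U \<omega> \<in> D} = (\<integral>\<^sup>+x\<in>D. emeasure (\<kappa> x) B \<partial>distr ?N borel U)" .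
qed

section \<open>Association inequalities\<close>

lemma mono_on_truncation:
  fixes m :: "real \<Rightarrow> real"
  shows "mono_on S m \<Longrightarrow> mono_on S (\<lambda>u. max a (min b (m u)))"
  by (intro mono_onI max.mono min.mono order_refl) (rule mono_onD)

text \<open>Reduces association inequalities to bounded functions, for which thresholds exist; the
  integrable product of \<open>\<bar>X \<omega>\<bar>\<close> and
  \<open>\<bar>W \<omega>\<bar>\<close> dominates. Truncation levels start at 1 because a later
  rescaling divides by the level.\<close>

lemma integral_nonneg_truncation:
  assumes X: "integrable M X" and W: "W \<in> borel_measurable M" "AE \<omega> in M. \<bar>W \<omega>\<bar> \<le> K"
    and trunc: "\<And>n. 0 \<le> (\<integral>\<omega>. max (- real (Suc n)) (min (real (Suc n)) (X \<omega>)) * W \<omega> \<partial>M)"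
  shows "0 \<le> (\<integral>\<omega>. X \<omega> * W \<omega> \<partial>M)"
proof -
  let ?X = "\<lambda>n \<omega>. max (- real (Suc n)) (min (real (Suc n)) (X \<omega>))"
  note [measurable] = W(1) borel_measurable_integrable[OF X]
  have "(\<lambda>n. \<integral>\<omega>. ?X n \<omega> * W \<omega> \<partial>M) \<longlonglongrightarrow> (\<integral>\<omega>. X \<omega> * W \<omega> \<partial>M)"
  proof (rule integral_dominated_convergence[where w = "\<lambda>\<omega>. \<bar>X \<omega>\<bar> * \<bar>W \<omega>\<bar>"])
    show "integrable M (\<lambda>\<omega>. \<bar>X \<omega>\<bar> * \<bar>W \<omega>\<bar>)"
      by (rule integrable_mult_bounded[OF integrable_abs[OF X]]) (use W in auto)
    show "AE \<omega> in M. (\<lambda>n. ?X n \<omega> * W \<omega>) \<longlonglongrightarrow> X \<omega> * W \<omega>"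
    proof (rule AE_I2)
      fix \<omega>
      obtain N :: nat where N: "\<bar>X \<omega>\<bar> \<le> real N" using real_arch_simple by blast
      have "?X n \<omega> = X \<omega>" if "N \<le> n" for n
        using N that by (auto simp: min_def max_def abs_le_iff)
      then have "\<forall>\<^sub>F n in sequentially. X \<omega> * W \<omega> = ?X n \<omega> * W \<omega>"
        by (auto simp: eventually_sequentially intro!: exI[of _ N])
      then show "(\<lambda>n. ?X n \<omega> * W \<omega>) \<longlonglongrightarrow> X \<omega> * W \<omega>"
        by (rule Lim_transform_eventually[OF tendsto_const])
    qed
    show "AE \<omega> in M. norm (?X n \<omega> * W \<omega>) \<le> \<bar>X \<omega>\<bar> * \<bar>W \<omega>\<bar>" for n
    proof (rule AE_I2)
      fix \<omega>
      have "\<bar>?X n \<omega>\<bar> \<le> \<bar>X \<omega>\<bar>" by (auto simp: min_def max_def)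
      then show "norm (?X n \<omega> * W \<omega>) \<le> \<bar>X \<omega>\<bar> * \<bar>W \<omega>\<bar>"
        by (simp add: abs_mult mult_right_mono)
    qed
  qed auto
  then show ?thesis by (rule LIMSEQ_le_const) (use trunc in auto)
qed

text \<open>
  No regular conditional distribution of \<open>U\<close> is needed: the threshold against which \<open>m\<close> is compared
  is a monotone, hence Borel, function of the conditional expectation of \<open>v(U)\<close>.
\<close>

lemma cond_chebyshev:
  fixes v m :: "real \<Rightarrow> real"
  assumes M: "prob_space M" and F: "subalgebra M F"
    and U[measurable]: "U \<in> borel_measurable M" and U_S: "AE \<omega> in M. U \<omega> \<in> S"
    and v[measurable]: "v \<in> borel_measurable borel" and v_mono: "mono_on S v" and v_bound: "\<And>u. \<bar>v u\<bar> \<le> 1"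
    and m[measurable]: "m \<in> borel_measurable borel" and m_mono: "mono_on S m" and m_int: "integrable M (\<lambda>\<omega>. m (U \<omega>))"
    and L: "L \<in> borel_measurable F" "AE \<omega> in M. 0 \<le> L \<omega> \<and> L \<omega> \<le> K"
  shows "0 \<le> (\<integral>\<omega>. m (U \<omega>) * ((v (U \<omega>) - real_cond_exp M F (\<lambda>\<omega>. v (U \<omega>)) \<omega>) * L \<omega>) \<partial>M)"
proof -
  interpret prob_space M by fact
  interpret F: finite_measure_subalgebra M F by unfold_locales fact
  let ?R = "real_cond_exp M F (\<lambda>\<omega>. v (U \<omega>))"
  have [measurable]: "L \<in> borel_measurable M" by (rule measurable_from_subalg[OF F L(1)])
  have iv: "integrable M (\<lambda>\<omega>. v (U \<omega>))"
    by (rule integrable_const_bound[of _ 1]) (use v_bound in auto)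
  have R: "AE \<omega> in M. - 1 \<le> ?R \<omega> \<and> ?R \<omega> \<le> 1"
    by (rule real_cond_exp_between[OF F.sigma_finite_subalgebra_axioms iv])
       (use v_bound in \<open>auto simp: abs_le_iff minus_le_iff\<close>)
  have L': "AE \<omega> in M. \<bar>L \<omega>\<bar> \<le> K" using L(2) by auto
  have W: "AE \<omega> in M. \<bar>(v (U \<omega>) - ?R \<omega>) * L \<omega>\<bar> \<le> 2 * K"
    using L(2) R
  proof eventually_elim
    case (elim \<omega>)
    have "\<bar>v (U \<omega>) - ?R \<omega>\<bar> * \<bar>L \<omega>\<bar> \<le> 2 * K"
      using elim v_bound[of "U \<omega>"] by (intro mult_mono) auto
    then show ?case by (simp add: abs_mult)
  qed
  show ?thesis
  proof (rule integral_nonneg_truncation[OF m_int _ W])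
    fix n
    define B where "B = real (Suc n)"
    define m' where "m' u = max (- B) (min B (m u))" for u
    have B: "0 \<le> B" and m'_bound: "\<And>u. \<bar>m' u\<bar> \<le> B" by (auto simp: B_def m'_def)
    have m'_mono: "mono_on S m'" unfolding m'_def by (rule mono_on_truncation[OF m_mono])
    have [measurable]: "m' \<in> borel_measurable borel" unfolding m'_def by measurable
    \<comment> \<open>The level separating \<open>m'\<close> on the two sides of the sign change of
      \<open>v - x\<close>. It is used at the random point \<open>x = ?R \<omega>\<close>.\<close>
    define t where "t x = threshold m' B {u \<in> S. v u - x < 0}" for x
    have "mono t" unfolding t_def mono_def using m'_bound B by (auto intro!: mono_threshold[where S = S])
    then have t[measurable]: "t \<in> borel_measurable borel" by (rule borel_measurable_mono)
    have t_bound: "\<bar>t x\<bar> \<le> B" for x unfolding t_def by (rule threshold_abs) (use m'_bound B in auto)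
    let ?W = "\<lambda>\<omega>. (v (U \<omega>) - ?R \<omega>) * L \<omega>"
    have iW: "integrable M ?W"
      by (rule integrable_const_bound[of _ "2 * K"]) (use W in auto)
    have im: "integrable M (\<lambda>\<omega>. ?W \<omega> * m' (U \<omega>))" "integrable M (\<lambda>\<omega>. ?W \<omega> * t (?R \<omega>))"
      by (rule integrable_mult_bounded[where B = B, OF iW], use m'_bound t_bound in auto)+
    have tL: "(\<lambda>\<omega>. t (?R \<omega>) * L \<omega>) \<in> borel_measurable F"
      by (intro borel_measurable_times L measurable_compose[OF _ t]) simp
    have tL_bound: "AE \<omega> in M. \<bar>t (?R \<omega>) * L \<omega>\<bar> \<le> B * K"
      using L(2) by eventually_elim (use t_bound B in \<open>auto simp: abs_mult intro!: mult_mono\<close>)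
    have itv: "integrable M (\<lambda>\<omega>. (t (?R \<omega>) * L \<omega>) * v (U \<omega>))" "integrable M (\<lambda>\<omega>. (t (?R \<omega>) * L \<omega>) * ?R \<omega>)"
      using integrable_mult_bounded[OF iv _ tL_bound] integrable_mult_bounded[OF F.real_cond_exp_int(1)[OF iv] _ tL_bound]
      by (simp_all add: mult.commute)
    \<comment> \<open>The residual of \<open>v (U \<omega>)\<close> given \<open>F\<close> is
      orthogonal to the bounded \<open>F\<close>-measurable factor
      \<open>t (?R \<omega>) * L \<omega>\<close>, so the random level costs nothing.\<close>
    have "(\<integral>\<omega>. ?W \<omega> * t (?R \<omega>) \<partial>M) = (\<integral>\<omega>. (t (?R \<omega>) * L \<omega>) * v (U \<omega>) - (t (?R \<omega>) * L \<omega>) * ?R \<omega> \<partial>M)"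
      by (simp add: algebra_simps)
    also have "\<dots> = (\<integral>\<omega>. (t (?R \<omega>) * L \<omega>) * v (U \<omega>) \<partial>M) - (\<integral>\<omega>. (t (?R \<omega>) * L \<omega>) * ?R \<omega> \<partial>M)"
      by (rule Bochner_Integration.integral_diff[OF itv])
    also have "\<dots> = 0" using F.real_cond_exp_intg(2)[OF itv(1) tL] by simp
    finally have 0: "(\<integral>\<omega>. ?W \<omega> * t (?R \<omega>) \<partial>M) = 0" .
    have "AE \<omega> in M. 0 \<le> ?W \<omega> * (m' (U \<omega>) - t (?R \<omega>))"
      using U_S L(2)
    proof eventually_elim
      case (elim \<omega>)
      have "0 \<le> (v (U \<omega>) - ?R \<omega>) * (m' (U \<omega>) - t (?R \<omega>))"
        unfolding t_def
        by (rule single_crossing_threshold[where d = "\<lambda>u. v u - ?R \<omega>", OF m'_mono m'_bound B _ elim(1)])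
           (use v_mono in \<open>force simp: mono_on_def\<close>)
      then have "0 \<le> L \<omega> * ((v (U \<omega>) - ?R \<omega>) * (m' (U \<omega>) - t (?R \<omega>)))" using elim by simp
      then show ?case by (simp add: mult_ac)
    qed
    then have "0 \<le> (\<integral>\<omega>. ?W \<omega> * (m' (U \<omega>) - t (?R \<omega>)) \<partial>M)" by (rule integral_nonneg_AE)
    also have "\<dots> = (\<integral>\<omega>. ?W \<omega> * m' (U \<omega>) \<partial>M) - (\<integral>\<omega>. ?W \<omega> * t (?R \<omega>) \<partial>M)"
      using im by (simp add: right_diff_distrib)
    finally show "0 \<le> (\<integral>\<omega>. max (- real (Suc n)) (min (real (Suc n)) (m (U \<omega>))) * ?W \<omega> \<partial>M)"
      using 0 by (simp add: m'_def B_def mult.commute)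
  qed simp
qed

text \<open>Since \<open>W\<close> depends on \<open>C\<close> only, \<open>m (U \<omega>)\<close>
  may be averaged given \<open>C\<close>, which leaves two increasing functions of the same
  variable. As \<open>W\<close> has mean zero under \<open>M\<close>, a constant separating level
  suffices.\<close>

lemma stoch_increasing_integral_nonneg:
  fixes m k :: "real \<Rightarrow> real"
  assumes M: "prob_space M" and U[measurable]: "U \<in> borel_measurable M" and C[measurable]: "C \<in> borel_measurable M"
    and inc: "stoch_increasing M S U C"
    and m[measurable]: "m \<in> borel_measurable borel" and m_mono: "mono_on S m" and m_int: "integrable M (\<lambda>\<omega>. m (U \<omega>))"
    and k: "mono_on T k" "AE \<omega> in M. C \<omega> \<in> T" "AE \<omega> in M. W \<omega> = k (C \<omega>)"
    and W: "W \<in> borel_measurable (sigma_gen M C)" "AE \<omega> in M. \<bar>W \<omega>\<bar> \<le> K" "(\<integral>\<omega>. W \<omega> \<partial>M) = 0"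
  shows "0 \<le> (\<integral>\<omega>. m (U \<omega>) * W \<omega> \<partial>M)"
proof -
  interpret prob_space M by fact
  interpret F: sigma_finite_subalgebra M "sigma_gen M C"
    by (rule sigma_finite_subalgebra_sigma_gen) fact+
  have [measurable]: "W \<in> borel_measurable M" by (rule measurable_from_subalg[OF F.subalg W(1)])
  have iW: "integrable M W" by (rule integrable_const_bound[of _ K]) (use W in auto)
  show ?thesis
  proof (rule integral_nonneg_truncation[OF m_int _ W(2)])
    fix n
    define B where "B = real (Suc n)"
    \<comment> \<open>Affine image of the truncated \<open>m\<close> between 0 and 1, as
      \<open>stoch_increasing\<close> requires. Mean zero of \<open>W\<close> cancels the shift when
      this is undone at the end.\<close>
    define \<phi> where "\<phi> u = (max (- B) (min B (m u)) + B) / (2 * B)" for u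
    have B: "0 < B" by (simp add: B_def)
    have \<phi>01: "0 \<le> \<phi> u \<and> \<phi> u \<le> 1" for u
      using B by (auto simp: \<phi>_def field_simps)
    have \<phi>_mono: "mono_on S \<phi>"
      using mono_on_truncation[OF m_mono, of "- B" B] B unfolding mono_on_def \<phi>_def
      by (auto intro!: divide_right_mono)
    have [measurable]: "\<phi> \<in> borel_measurable borel" unfolding \<phi>_def by measurable
    let ?E = "real_cond_exp M (sigma_gen M C) (\<lambda>\<omega>. \<phi> (U \<omega>))"
    obtain \<psi> T' where \<psi>: "mono_on T' \<psi>" "AE \<omega> in M. C \<omega> \<in> T'" "AE \<omega> in M. ?E \<omega> = \<psi> (C \<omega>)"
      using inc \<phi>01 \<phi>_mono unfolding stoch_increasing_def by (metis \<open>\<phi> \<in> borel_measurable borel\<close>)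
    have i\<phi>: "integrable M (\<lambda>\<omega>. \<phi> (U \<omega>))"
      by (rule integrable_const_bound[of _ 1]) (use \<phi>01 in auto)
    have E01: "AE \<omega> in M. 0 \<le> ?E \<omega> \<and> ?E \<omega> \<le> 1"
      by (rule real_cond_exp_between[OF F.sigma_finite_subalgebra_axioms i\<phi>]) (use \<phi>01 in auto)
    \<comment> \<open>The function \<open>\<psi>\<close> is bounded only where it agrees with the
      conditional expectation. The restriction supplies the bound that the threshold needs and still
      carries \<open>C\<close>.\<close>
    define T'' where "T'' = {c \<in> T \<inter> T'. \<bar>\<psi> c\<bar> \<le> 1}"
    define s where "s = threshold \<psi> 1 {c \<in> T''. k c < 0}"
    have "AE \<omega> in M. 0 \<le> W \<omega> * (?E \<omega> - s)"
      using E01 \<psi>(2,3) k(2,3)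
    proof eventually_elim
      case (elim \<omega>)
      have "0 \<le> k (C \<omega>) * (\<psi> (C \<omega>) - s)"
        unfolding s_def
      proof (rule single_crossing_threshold)
        show "mono_on T'' \<psi>" using \<psi>(1) by (auto simp: mono_on_def T''_def)
        show "0 \<le> k c'" if "c \<in> T''" "c' \<in> T''" "c < c'" "0 < k c" for c c'
          using k(1) that by (force simp: mono_on_def T''_def)
        show "C \<omega> \<in> T''" using elim by (auto simp: T''_def)
      qed (auto simp: T''_def)
      then show ?case using elim by simp
    qed
    then have "0 \<le> (\<integral>\<omega>. W \<omega> * (?E \<omega> - s) \<partial>M)" by (rule integral_nonneg_AE)
    also have "\<dots> = (\<integral>\<omega>. W \<omega> * ?E \<omega> \<partial>M) - s * (\<integral>\<omega>. W \<omega> \<partial>M)"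
    proof -
      have "AE \<omega> in M. \<bar>?E \<omega>\<bar> \<le> 1" using E01 by eventually_elim auto
      then have "integrable M (\<lambda>\<omega>. W \<omega> * ?E \<omega>)" by (intro integrable_mult_bounded[OF iW]) auto
      then show ?thesis using iW by (simp add: right_diff_distrib mult.commute)
    qed
    also have "\<dots> = (\<integral>\<omega>. W \<omega> * \<phi> (U \<omega>) \<partial>M)"
      using F.real_cond_exp_intg(2)[OF integrable_mult_bounded[where B = 1, OF iW] W(1), of "\<lambda>\<omega>. \<phi> (U \<omega>)"] \<phi>01 W(3)
      by (simp add: abs_le_iff)
    finally have 0: "0 \<le> (\<integral>\<omega>. W \<omega> * \<phi> (U \<omega>) \<partial>M)" .
    have "(\<integral>\<omega>. max (- B) (min B (m (U \<omega>))) * W \<omega> \<partial>M) = (\<integral>\<omega>. 2 * B * (W \<omega> * \<phi> (U \<omega>)) - B * W \<omega> \<partial>M)"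
      using B by (intro Bochner_Integration.integral_cong) (auto simp: \<phi>_def field_simps)
    also have "\<dots> = 2 * B * (\<integral>\<omega>. W \<omega> * \<phi> (U \<omega>) \<partial>M) - B * (\<integral>\<omega>. W \<omega> \<partial>M)"
      using iW integrable_mult_bounded[where B = 1, OF iW, of "\<lambda>\<omega>. \<phi> (U \<omega>)"] \<phi>01 by (simp add: abs_le_iff)
    finally show "0 \<le> (\<integral>\<omega>. max (- real (Suc n)) (min (real (Suc n)) (m (U \<omega>))) * W \<omega> \<partial>M)"
      using 0 B W(3) by (simp add: B_def)
  qed simp
qed

section \<open>Comparison within one treatment arm\<close>

lemma real_cond_exp_one_minus:
  assumes M: "prob_space M" and F: "sigma_finite_subalgebra M F" and f: "integrable M f"
  shows "AE \<omega> in M. real_cond_exp M F (\<lambda>\<omega>. 1 - f \<omega>) \<omega> = 1 - real_cond_exp M F f \<omega>"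
proof -
  interpret prob_space M by fact
  interpret sigma_finite_subalgebra M F by fact
  have "AE \<omega> in M. real_cond_exp M F (\<lambda>_. 1) \<omega> = 1" by (rule real_cond_exp_F_meas) auto
  moreover have "AE \<omega> in M. real_cond_exp M F (\<lambda>\<omega>. 1 - f \<omega>) \<omega> =
      real_cond_exp M F (\<lambda>_. 1) \<omega> - real_cond_exp M F f \<omega>"
    by (rule real_cond_exp_diff) (use f in auto)
  ultimately show ?thesis by eventually_elim simp
qed

text \<open>Averaging the lower bound on \<open>w\<close> over \<open>U\<close> bounds the
  probability of the arm below by \<open>\<epsilon>\<close>; this makes conditioning on the arm
  yield a probability measure.\<close>

lemma measure_treatment_pos:
  fixes A :: "'w \<Rightarrow> real"
  assumes M: "prob_space M" and [measurable]: "U \<in> borel_measurable M" "A \<in> borel_measurable M"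
    and U_S: "AE \<omega> in M. U \<omega> \<in> S" and w: "is_cond_exp M (\<lambda>\<omega>. indicator {a} (A \<omega>)) U w"
    and w_pos: "0 < \<epsilon>" "\<And>u. u \<in> S \<Longrightarrow> \<epsilon> \<le> w u"
  shows "0 < measure M {\<omega> \<in> space M. A \<omega> = a}"
proof -
  interpret prob_space M by fact
  let ?I = "\<lambda>\<omega>. indicator {a} (A \<omega>) :: real"
  interpret F: sigma_finite_subalgebra M "sigma_gen M U"
    by (rule sigma_finite_subalgebra_sigma_gen) fact+
  have int: "integrable M ?I" by (rule integrable_const_bound[of _ 1]) auto
  have "(\<integral>\<omega>. \<epsilon> \<partial>M) \<le> (\<integral>\<omega>. real_cond_exp M (sigma_gen M U) ?I \<omega> \<partial>M)"
  proof (rule integral_mono_AE)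
    have "AE \<omega> in M. w (U \<omega>) = real_cond_exp M (sigma_gen M U) ?I \<omega>"
      using w by (simp add: is_cond_exp_def)
    then show "AE \<omega> in M. \<epsilon> \<le> real_cond_exp M (sigma_gen M U) ?I \<omega>"
      using U_S by eventually_elim (metis w_pos(2))
  qed (use F.real_cond_exp_int(1)[OF int] in auto)
  also have "\<dots> = (\<integral>\<omega>. ?I \<omega> \<partial>M)" by (rule F.real_cond_exp_int(2)[OF int])
  also have "\<dots> = (\<integral>\<omega>. indicator {\<omega> \<in> space M. A \<omega> = a} \<omega> \<partial>M)"
    by (intro Bochner_Integration.integral_cong) (auto split: split_indicator)
  finally show ?thesis using w_pos by (simp add: prob_space)
qed

text \<open>The sign \<open>\<sigma>\<close> treats both arms at once: it is chosen so that
  \<open>\<sigma> * w u\<close> increases on \<open>S\<close>. Exchangeability speaks of the pair of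
  potential outcomes, hence \<open>X\<close> stands for the pair and \<open>\<phi>\<close> for a
  projection.\<close>

lemma arm_comparison:
  fixes M :: "'w measure" and U C A Y Ya :: "'w \<Rightarrow> real" and X :: "'w \<Rightarrow> 'b::topological_space"
    and w m r :: "real \<Rightarrow> real" and \<sigma> :: real
  assumes M: "prob_space M" and U[measurable]: "U \<in> borel_measurable M" and C[measurable]: "C \<in> borel_measurable M"
    and A[measurable]: "A \<in> borel_measurable M" and Y[measurable]: "Y \<in> borel_measurable M"
    and X[measurable]: "X \<in> M \<rightarrow>\<^sub>M borel" and Ya: "Ya = (\<lambda>\<omega>. \<phi> (X \<omega>))" and \<phi>[measurable]: "\<phi> \<in> borel_measurable borel"
    and U_S: "AE \<omega> in M. U \<omega> \<in> S"
    and w: "is_cond_exp M (\<lambda>\<omega>. indicator {a} (A \<omega>)) U w"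
    and w01: "\<And>u. 0 \<le> w u \<and> w u \<le> 1" and w_pos: "0 < \<epsilon>" "\<And>u. u \<in> S \<Longrightarrow> \<epsilon> \<le> w u"
    and m: "is_cond_exp (given M A a) Y U m" and r: "is_cond_exp (given M A a) Y C r"
    and int_Y: "integrable M Y" and int_Ya: "integrable M Ya" and int_r: "integrable (distr M borel C) r"
    and consistent: "AE \<omega> in M. A \<omega> = a \<longrightarrow> Y \<omega> = Ya \<omega>"
    and exch: "cond_indep M X A U" and nondiff: "cond_indep M C (\<lambda>\<omega>. (A \<omega>, Y \<omega>)) U"
    and m_mono: "mono_on S m" and \<sigma>: "\<sigma> = 1 \<or> \<sigma> = - 1" and w_mono: "mono_on S (\<lambda>u. \<sigma> * w u)"
    and inc: "stoch_increasing M S U C" "stoch_increasing (given M A a) S U C"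
  shows "0 \<le> \<sigma> * (mean_unadj M A Y a - mean_adj M C r)"
    and "0 \<le> \<sigma> * (mean_adj M C r - (\<integral>\<omega>. Ya \<omega> \<partial>M))"
proof -
  interpret prob_space M by fact
  define I where "I \<omega> = (indicator {a} (A \<omega>) :: real)" for \<omega>
  define q where "q = (\<integral>\<omega>. I \<omega> \<partial>M)"
  let ?FU = "sigma_gen M U" and ?FC = "sigma_gen M C" and ?N = "given M A a"
  interpret FU: sigma_finite_subalgebra M ?FU by (rule sigma_finite_subalgebra_sigma_gen) fact+
  interpret FC: sigma_finite_subalgebra M ?FC by (rule sigma_finite_subalgebra_sigma_gen) fact+
  have [measurable]: "I \<in> borel_measurable M" unfolding I_def by measurable
  have I01: "0 \<le> I \<omega>" "I \<omega> \<le> 1" for \<omega> by (auto simp: I_def split: split_indicator)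
  have w_meas[measurable]: "w \<in> borel_measurable borel" and IU: "AE \<omega> in M. real_cond_exp M ?FU I \<omega> = w (U \<omega>)"
    using w by (auto simp: is_cond_exp_def I_def[abs_def])
  have wU: "AE \<omega> in M. \<epsilon> \<le> w (U \<omega>) \<and> w (U \<omega>) \<le> 1"
    using U_S by eventually_elim (use w01 w_pos in auto)
  have int1: "integrable M f" if "f \<in> borel_measurable M" "AE \<omega> in M. \<bar>f \<omega>\<bar> \<le> K" for f :: "'w \<Rightarrow> real" and K
    by (rule integrable_const_bound[of _ K]) (use that in auto)
  have int_I: "integrable M I" by (rule int1[of _ 1]) (use I01 in auto)
  have int_w: "integrable M (\<lambda>\<omega>. w (U \<omega>))" by (rule int1[of _ 1]) (use w01 in auto)
  have int_I_mult: "integrable M (\<lambda>\<omega>. I \<omega> * f \<omega>)" if "integrable M f" for f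
    by (subst mult.commute, rule integrable_mult_bounded[where B = 1, OF that]) (use I01 in auto)
  have comp_U: "(\<lambda>\<omega>. f (U \<omega>)) \<in> borel_measurable ?FU" if "f \<in> borel_measurable borel" for f :: "real \<Rightarrow> real"
    by (rule measurable_compose[OF measurable_sigma_gen that])
  have comp_C: "(\<lambda>\<omega>. f (C \<omega>)) \<in> borel_measurable ?FC" if "f \<in> borel_measurable borel" for f :: "real \<Rightarrow> real"
    by (rule measurable_compose[OF measurable_sigma_gen that])

  have q_prob: "q = measure M {\<omega> \<in> space M. A \<omega> = a}"
  proof -
    have "q = (\<integral>\<omega>. indicator {\<omega> \<in> space M. A \<omega> = a} \<omega> \<partial>M)"
      unfolding q_def I_def by (intro Bochner_Integration.integral_cong) (auto split: split_indicator)
    then show ?thesis by simp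
  qed
  have q_pos: "0 < q" unfolding q_prob by (rule measure_treatment_pos[OF M U A U_S w w_pos])
  have q0: "measure M {\<omega> \<in> space M. A \<omega> = a} \<noteq> 0" using q_pos q_prob by simp
  interpret N: prob_space ?N by (rule prob_space_given[OF M A q0])
  have sets_N[measurable_cong]: "sets ?N = sets M" and space_N: "space ?N = space M"
    using sets_given[OF M A q0] space_given[OF M A q0] by auto
  have AE_N: "(AE \<omega> in M. P \<omega>) \<Longrightarrow> (AE \<omega> in ?N. P \<omega>)" for P
    using AE_given_iff[OF M A q0, of P] by auto
  have int_N: "integrable ?N f \<longleftrightarrow> integrable M (\<lambda>\<omega>. I \<omega> * f \<omega>)" if "f \<in> borel_measurable M" for f :: "'w \<Rightarrow> real"
    using integrable_given_iff[OF M A q0 that] by (simp add: I_def)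
  have integral_N: "(\<integral>\<omega>. f \<omega> \<partial>?N) = (\<integral>\<omega>. I \<omega> * f \<omega> \<partial>M) / q" if "f \<in> borel_measurable M" for f :: "'w \<Rightarrow> real"
    using integral_given[OF M A q0 that] by (simp add: I_def q_prob)
  have F_N: "sigma_gen ?N Z = sigma_gen M Z" for Z by (simp add: sigma_gen_def space_N)
  have meas_N: "f \<in> borel_measurable ?N" if "f \<in> borel_measurable M" for f :: "'w \<Rightarrow> real"
    using that by (simp cong: measurable_cong_sets)
  interpret NU: sigma_finite_subalgebra ?N ?FU
    using sigma_finite_subalgebra_sigma_gen[OF N.prob_space_axioms meas_N[OF U]] by (simp add: F_N)
  interpret NC: sigma_finite_subalgebra ?N ?FC
    using sigma_finite_subalgebra_sigma_gen[OF N.prob_space_axioms meas_N[OF C]] by (simp add: F_N)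

  have m_meas[measurable]: "m \<in> borel_measurable borel" and mE: "AE \<omega> in ?N. m (U \<omega>) = real_cond_exp ?N ?FU Y \<omega>"
    using m by (auto simp: is_cond_exp_def F_N)
  have r_meas[measurable]: "r \<in> borel_measurable borel" and rE: "AE \<omega> in ?N. r (C \<omega>) = real_cond_exp ?N ?FC Y \<omega>"
    using r by (auto simp: is_cond_exp_def F_N)
  have int_NY: "integrable ?N Y" using int_Y by (simp add: int_N int_I_mult)
  have int_Nm: "integrable ?N (\<lambda>\<omega>. m (U \<omega>))"
    by (rule integrable_cong_AE_imp[OF NU.real_cond_exp_int(1)[OF int_NY]])
       (use mE in \<open>auto simp: meas_N\<close>)
  have int_Im: "integrable M (\<lambda>\<omega>. I \<omega> * m (U \<omega>))" using int_Nm by (simp add: int_N)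
  have wm: "integrable M (\<lambda>\<omega>. m (U \<omega>) * w (U \<omega>))"
    and Im: "f \<in> borel_measurable borel \<Longrightarrow> integrable M (\<lambda>\<omega>. f (U \<omega>) * I \<omega>) \<Longrightarrow>
      (\<integral>\<omega>. f (U \<omega>) * w (U \<omega>) \<partial>M) = (\<integral>\<omega>. f (U \<omega>) * I \<omega> \<partial>M)" for f :: "real \<Rightarrow> real"
  proof -
    have "integrable M (\<lambda>\<omega>. m (U \<omega>) * real_cond_exp M ?FU I \<omega>)"
      by (rule FU.real_cond_exp_intg(1)) (use int_Im in \<open>auto simp: comp_U mult.commute\<close>)
    then show "integrable M (\<lambda>\<omega>. m (U \<omega>) * w (U \<omega>))"
      by (rule integrable_cong_AE_imp) (use IU in auto)
    assume [measurable]: "f \<in> borel_measurable borel" and f: "integrable M (\<lambda>\<omega>. f (U \<omega>) * I \<omega>)"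
    have "(\<integral>\<omega>. f (U \<omega>) * w (U \<omega>) \<partial>M) = (\<integral>\<omega>. f (U \<omega>) * real_cond_exp M ?FU I \<omega> \<partial>M)"
      by (rule integral_cong_AE) (use IU in auto)
    also have "\<dots> = (\<integral>\<omega>. f (U \<omega>) * I \<omega> \<partial>M)"
      by (rule FU.real_cond_exp_intg(2)[OF f]) (auto simp: comp_U)
    finally show "(\<integral>\<omega>. f (U \<omega>) * w (U \<omega>) \<partial>M) = (\<integral>\<omega>. f (U \<omega>) * I \<omega> \<partial>M)" .
  qed
  \<comment> \<open>Integrability of \<open>m (U \<omega>)\<close> is inherited from
    \<open>Y\<close> only within the arm; the lower bound on \<open>w\<close> extends it to
    \<open>M\<close>.\<close>
  have int_m: "integrable M (\<lambda>\<omega>. m (U \<omega>))"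
  proof (rule Bochner_Integration.integrable_bound[of M "\<lambda>\<omega>. m (U \<omega>) * w (U \<omega>) / \<epsilon>"])
    show "AE \<omega> in M. norm (m (U \<omega>)) \<le> norm (m (U \<omega>) * w (U \<omega>) / \<epsilon>)"
      using wU
    proof eventually_elim
      case (elim \<omega>)
      have "\<bar>m (U \<omega>)\<bar> * \<epsilon> \<le> \<bar>m (U \<omega>)\<bar> * w (U \<omega>)" using elim by (intro mult_left_mono) auto
      then show ?case using w01[of "U \<omega>"] w_pos by (simp add: abs_mult pos_le_divide_eq)
    qed
  qed (use wm in auto)
  \<comment> \<open>The arm's conditional mean times the probability of the arm: this translates
    \<open>m\<close>, a version under the conditional measure, into a conditional expectation under
    \<open>M\<close>.\<close>
  have IYU: "AE \<omega> in M. real_cond_exp M ?FU (\<lambda>\<omega>. I \<omega> * Y \<omega>) \<omega> = m (U \<omega>) * w (U \<omega>)"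
    unfolding sigma_gen_def
  proof (rule real_cond_exp_vimageI[OF M U int_I_mult[OF int_Y] wm])
    show "(\<lambda>\<omega>. m (U \<omega>) * w (U \<omega>)) \<in> borel_measurable (vimage_algebra (space M) U borel)"
      using comp_U[of "\<lambda>u. m u * w u"] by (simp add: sigma_gen_def)
    fix B :: "real set" assume [measurable]: "B \<in> sets borel"
    have iB: "integrable P (\<lambda>\<omega>. indicator B (U \<omega>) * f \<omega>)" if "integrable P f" "U \<in> borel_measurable P" for P and f :: "'w \<Rightarrow> real"
      by (subst mult.commute, rule integrable_mult_bounded[where B = 1, OF that(1)])
         (use that(2) in \<open>auto split: split_indicator\<close>)
    have "(\<integral>\<omega>. indicator B (U \<omega>) * (I \<omega> * Y \<omega>) \<partial>M) = q * (\<integral>\<omega>. indicator B (U \<omega>) * Y \<omega> \<partial>?N)"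
      using q_pos by (simp add: integral_N mult_ac)
    also have "(\<integral>\<omega>. indicator B (U \<omega>) * Y \<omega> \<partial>?N) = (\<integral>\<omega>. indicator B (U \<omega>) * real_cond_exp ?N ?FU Y \<omega> \<partial>?N)"
      by (rule NU.real_cond_exp_intg(2)[symmetric]) (auto simp: comp_U iB int_NY meas_N)
    also have "\<dots> = (\<integral>\<omega>. indicator B (U \<omega>) * m (U \<omega>) \<partial>?N)"
      by (rule integral_cong_AE) (use mE in \<open>auto simp: meas_N\<close>)
    also have "q * \<dots> = (\<integral>\<omega>. (indicator B (U \<omega>) * m (U \<omega>)) * I \<omega> \<partial>M)"
      using q_pos by (simp add: integral_N mult_ac)
    also have "\<dots> = (\<integral>\<omega>. (indicator B (U \<omega>) * m (U \<omega>)) * w (U \<omega>) \<partial>M)"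
      using Im[of "\<lambda>u. indicator B u * m u"] iB[OF int_Im U] by (simp add: mult_ac)
    finally show "(\<integral>\<omega>. indicator B (U \<omega>) * (I \<omega> * Y \<omega>) \<partial>M) = (\<integral>\<omega>. indicator B (U \<omega>) * (m (U \<omega>) * w (U \<omega>)) \<partial>M)"
      by (simp add: mult_ac)
  qed

  have AY: "(\<lambda>\<omega>. (A \<omega>, Y \<omega>)) \<in> borel_measurable M" unfolding borel_prod[symmetric] by measurable
  have fst_meas: "(\<lambda>z. indicator {a} (fst z) :: real) \<in> borel_measurable (borel :: (real \<times> real) measure)"
    and snd_meas: "(\<lambda>z. indicator {a} (fst z) * snd z) \<in> borel_measurable (borel :: (real \<times> real) measure)"
    unfolding borel_prod[symmetric] by measurable
  \<comment> \<open>Nondifferentiality in the two forms used below: against functions of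
    \<open>U\<close> and \<open>C\<close>, \<open>I \<omega>\<close> acts as
    \<open>w (U \<omega>)\<close> and \<open>I \<omega> * Y \<omega>\<close> as
    \<open>m (U \<omega>) * w (U \<omega>)\<close>.\<close>
  note ci_I = cond_indep_integral_cond_exp(2)[where \<phi> = "\<lambda>z. indicator {a} (fst z)",
      OF M AY C U nondiff fst_meas, unfolded fst_conv, folded I_def, OF int_I _ _ _ _ IU]
  note ci_IY = cond_indep_integral_cond_exp(2)[where \<phi> = "\<lambda>z. indicator {a} (fst z) * snd z",
      OF M AY C U nondiff snd_meas, unfolded fst_conv snd_conv, folded I_def, OF int_I_mult[OF int_Y] _ _ _ _ IYU]

  define \<rho> where "\<rho> = real_cond_exp M ?FC (\<lambda>\<omega>. w (U \<omega>))"
  have \<rho>_FC: "\<rho> \<in> borel_measurable ?FC" and [measurable]: "\<rho> \<in> borel_measurable M" by (simp_all add: \<rho>_def)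
  have \<rho>_bound: "AE \<omega> in M. \<epsilon> \<le> \<rho> \<omega> \<and> \<rho> \<omega> \<le> 1"
    unfolding \<rho>_def by (rule real_cond_exp_between) (use FC.sigma_finite_subalgebra_axioms int_w wU in auto)
  have inv_bound: "AE \<omega> in M. \<bar>1 / \<rho> \<omega>\<bar> \<le> 1 / \<epsilon>"
    using \<rho>_bound by eventually_elim (use w_pos in \<open>auto simp: frac_le\<close>)
  have inv_FC: "(\<lambda>\<omega>. 1 / \<rho> \<omega>) \<in> borel_measurable ?FC" using \<rho>_FC by simp
  \<comment> \<open>Thus \<open>\<rho>\<close> is also the probability of the arm given
    \<open>C\<close>. Inverse weighting uses this reading, the association inequality uses the one
    through \<open>w\<close>.\<close>
  have IC: "AE \<omega> in M. real_cond_exp M ?FC I \<omega> = \<rho> \<omega>"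
    unfolding sigma_gen_def
  proof (rule real_cond_exp_vimageI[OF M C int_I])
    show "integrable M \<rho>" unfolding \<rho>_def using int_w by auto
    show "\<rho> \<in> borel_measurable (vimage_algebra (space M) C borel)" using \<rho>_FC by (simp add: sigma_gen_def)
    fix B :: "real set" assume [measurable]: "B \<in> sets borel"
    have iB: "integrable M (\<lambda>\<omega>. indicator B (C \<omega>) * w (U \<omega>))"
      by (subst mult.commute, rule integrable_mult_bounded[where B = 1, OF int_w]) (auto split: split_indicator)
    have "(\<integral>\<omega>. indicator B (C \<omega>) * I \<omega> \<partial>M) = (\<integral>\<omega>. w (U \<omega>) * indicator B (C \<omega>) \<partial>M)"
      using ci_I[of "\<lambda>_. 1" "\<lambda>\<omega>. indicator B (C \<omega>)" 1] int_I
      by (simp add: comp_C mult.commute)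
    also have "\<dots> = (\<integral>\<omega>. indicator B (C \<omega>) * \<rho> \<omega> \<partial>M)"
      unfolding \<rho>_def using FC.real_cond_exp_intg(2)[OF iB] by (simp add: comp_C mult.commute)
    finally show "(\<integral>\<omega>. indicator B (C \<omega>) * I \<omega> \<partial>M) = (\<integral>\<omega>. indicator B (C \<omega>) * \<rho> \<omega> \<partial>M)" .
  qed

  have unadj: "mean_unadj M A Y a = (\<integral>\<omega>. m (U \<omega>) \<partial>?N)"
  proof -
    have "(\<integral>\<omega>. Y \<omega> \<partial>?N) = (\<integral>\<omega>. real_cond_exp ?N ?FU Y \<omega> \<partial>?N)"
      by (rule NU.real_cond_exp_int(2)[OF int_NY, symmetric])
    also have "\<dots> = (\<integral>\<omega>. m (U \<omega>) \<partial>?N)"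
      by (rule integral_cong_AE) (use mE in \<open>auto simp: meas_N\<close>)
    finally show ?thesis by (simp add: mean_unadj_def)
  qed
  \<comment> \<open>Inverse probability weighting: inserting
    \<open>I \<omega> / \<rho> \<omega>\<close> leaves the mean of \<open>r (C \<omega>)\<close>
    unchanged and moves the integral into the arm, where \<open>r (C \<omega>)\<close> can be
    replaced by \<open>Y \<omega>\<close>.\<close>
  have adj_w: "mean_adj M C r = (\<integral>\<omega>. m (U \<omega>) * w (U \<omega>) * (1 / \<rho> \<omega>) \<partial>M)"
  proof -
    have int_rC: "integrable M (\<lambda>\<omega>. r (C \<omega>))" using int_r by (subst (asm) integrable_distr_eq) auto
    have rF: "(\<lambda>\<omega>. r (C \<omega>) * (1 / \<rho> \<omega>)) \<in> borel_measurable ?FC"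
      using comp_C[OF r_meas] inv_FC by (rule borel_measurable_times)
    have int_rI: "integrable M (\<lambda>\<omega>. (r (C \<omega>) * (1 / \<rho> \<omega>)) * I \<omega>)"
      using int_I_mult[OF integrable_mult_bounded[OF int_rC _ inv_bound]] by (simp add: mult.commute)
    have "mean_adj M C r = (\<integral>\<omega>. r (C \<omega>) \<partial>M)" unfolding mean_adj_def by (subst integral_distr) auto
    also have "\<dots> = (\<integral>\<omega>. (r (C \<omega>) * (1 / \<rho> \<omega>)) * real_cond_exp M ?FC I \<omega> \<partial>M)"
    proof (rule integral_cong_AE)
      show "AE \<omega> in M. r (C \<omega>) = (r (C \<omega>) * (1 / \<rho> \<omega>)) * real_cond_exp M ?FC I \<omega>"
        using IC \<rho>_bound by eventually_elim (use w_pos in auto)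
    qed auto
    also have "\<dots> = (\<integral>\<omega>. (r (C \<omega>) * (1 / \<rho> \<omega>)) * I \<omega> \<partial>M)"
      by (rule FC.real_cond_exp_intg(2)[OF int_rI rF]) simp
    also have "\<dots> = q * (\<integral>\<omega>. (1 / \<rho> \<omega>) * r (C \<omega>) \<partial>?N)"
      using q_pos by (simp add: integral_N mult_ac)
    also have "(\<integral>\<omega>. (1 / \<rho> \<omega>) * r (C \<omega>) \<partial>?N) = (\<integral>\<omega>. (1 / \<rho> \<omega>) * real_cond_exp ?N ?FC Y \<omega> \<partial>?N)"
      by (rule integral_cong_AE) (use rE in \<open>auto simp: meas_N\<close>)
    also have "\<dots> = (\<integral>\<omega>. (1 / \<rho> \<omega>) * Y \<omega> \<partial>?N)"
    proof (rule NC.real_cond_exp_intg(2)[OF _ inv_FC])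
      show "integrable ?N (\<lambda>\<omega>. (1 / \<rho> \<omega>) * Y \<omega>)"
        using integrable_mult_bounded[OF int_NY _ AE_N[OF inv_bound]] by (simp add: meas_N mult.commute)
    qed (simp add: meas_N)
    also have "q * \<dots> = (\<integral>\<omega>. I \<omega> * Y \<omega> * (1 / \<rho> \<omega>) \<partial>M)"
      using q_pos by (simp add: integral_N mult_ac)
    also have "\<dots> = (\<integral>\<omega>. m (U \<omega>) * w (U \<omega>) * (1 / \<rho> \<omega>) \<partial>M)"
      using ci_IY[of "\<lambda>_. 1", OF _ _ inv_FC inv_bound] int_I_mult[OF int_Y] by simp
    finally show ?thesis .
  qed
  \<comment> \<open>The factor \<open>w (U \<omega>)\<close> is turned back into
    \<open>I \<omega>\<close>. As \<open>I \<omega> / q\<close> is the density of the arm, weight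
    \<open>q / \<rho> \<omega>\<close> remains.\<close>
  have adj_N: "mean_adj M C r = (\<integral>\<omega>. m (U \<omega>) * (q / \<rho> \<omega>) \<partial>?N)"
  proof -
    have "mean_adj M C r = (\<integral>\<omega>. I \<omega> * m (U \<omega>) * (1 / \<rho> \<omega>) \<partial>M)"
      using ci_I[OF comp_U[OF m_meas] int_Im inv_FC inv_bound] by (simp add: adj_w mult.commute)
    moreover have "(\<integral>\<omega>. I \<omega> * (m (U \<omega>) * (q / \<rho> \<omega>)) \<partial>M) = q * (\<integral>\<omega>. I \<omega> * m (U \<omega>) * (1 / \<rho> \<omega>) \<partial>M)"
      by (subst integral_mult_right_zero[symmetric]) (simp add: mult_ac)
    ultimately show ?thesis using q_pos by (simp add: integral_N)
  qed
  \<comment> \<open>Inverse weighting by \<open>w (U \<omega>)\<close>: consistency swaps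
    \<open>Y\<close> for \<open>Ya\<close> inside the arm, and exchangeability then cancels the
    indicator against the weight.\<close>
  have EYa: "(\<integral>\<omega>. Ya \<omega> \<partial>M) = (\<integral>\<omega>. m (U \<omega>) \<partial>M)"
  proof -
    have w_inv: "AE \<omega> in M. \<bar>1 / w (U \<omega>)\<bar> \<le> 1 / \<epsilon>"
      using wU by eventually_elim (use w_pos in \<open>auto simp: frac_le\<close>)
    have w_inv_FU: "(\<lambda>\<omega>. 1 / w (U \<omega>)) \<in> borel_measurable ?FU" by (rule comp_U[of "\<lambda>u. 1 / w u"]) simp
    note [measurable] = borel_measurable_integrable[OF int_Ya]
    have "(\<integral>\<omega>. m (U \<omega>) \<partial>M) = (\<integral>\<omega>. (1 / w (U \<omega>)) * real_cond_exp M ?FU (\<lambda>\<omega>. I \<omega> * Y \<omega>) \<omega> \<partial>M)"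
    proof (rule integral_cong_AE)
      show "AE \<omega> in M. m (U \<omega>) = (1 / w (U \<omega>)) * real_cond_exp M ?FU (\<lambda>\<omega>. I \<omega> * Y \<omega>) \<omega>"
        using IYU wU by eventually_elim (use w_pos in auto)
    qed auto
    also have "\<dots> = (\<integral>\<omega>. (1 / w (U \<omega>)) * (I \<omega> * Y \<omega>) \<partial>M)"
    proof (rule FU.real_cond_exp_intg(2)[OF _ w_inv_FU])
      show "integrable M (\<lambda>\<omega>. 1 / w (U \<omega>) * (I \<omega> * Y \<omega>))"
        using integrable_mult_bounded[OF int_I_mult[OF int_Y] _ w_inv] by (simp add: mult.commute)
    qed simp
    also have "\<dots> = (\<integral>\<omega>. \<phi> (X \<omega>) * (1 / w (U \<omega>)) * indicator {a} (A \<omega>) \<partial>M)"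
      by (rule integral_cong_AE) (use consistent in \<open>auto simp: Ya I_def split: split_indicator\<close>)
    also have "\<dots> = (\<integral>\<omega>. \<phi> (X \<omega>) * (1 / w (U \<omega>)) * real_cond_exp M ?FU (\<lambda>\<omega>. indicator {a} (A \<omega>)) \<omega> \<partial>M)"
      using int_Ya integrable_mult_bounded[OF int_Ya _ w_inv]
      by (intro cond_indep_integral[OF M X A U exch \<phi> _ w_inv_FU]) (auto simp: Ya)
    also have "\<dots> = (\<integral>\<omega>. Ya \<omega> \<partial>M)"
    proof (rule integral_cong_AE)
      show "AE \<omega> in M. \<phi> (X \<omega>) * (1 / w (U \<omega>)) * real_cond_exp M ?FU (\<lambda>\<omega>. indicator {a} (A \<omega>)) \<omega> = Ya \<omega>"
        using IU wU unfolding I_def[abs_def] by eventually_elim (use w_pos in \<open>auto simp: Ya\<close>)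
    qed auto
    finally show ?thesis by simp
  qed

  have \<sigma>_abs: "\<bar>\<sigma>\<bar> = 1" "\<sigma> * \<sigma> = 1" using \<sigma> by auto
  show "0 \<le> \<sigma> * (mean_adj M C r - (\<integral>\<omega>. Ya \<omega> \<partial>M))"
  proof -
    have "0 \<le> (\<integral>\<omega>. m (U \<omega>) * ((\<sigma> * w (U \<omega>) - real_cond_exp M ?FC (\<lambda>\<omega>. \<sigma> * w (U \<omega>)) \<omega>) * (1 / \<rho> \<omega>)) \<partial>M)"
    proof (rule cond_chebyshev[OF M FC.subalg U U_S _ w_mono _ m_meas m_mono int_m inv_FC])
      show "\<bar>\<sigma> * w u\<bar> \<le> 1" for u using w01[of u] \<sigma>_abs by (simp add: abs_mult)
      show "AE \<omega> in M. 0 \<le> 1 / \<rho> \<omega> \<and> 1 / \<rho> \<omega> \<le> 1 / \<epsilon>"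
        using \<rho>_bound by eventually_elim (use w_pos in \<open>auto simp: frac_le\<close>)
    qed measurable
    also have "\<dots> = (\<integral>\<omega>. \<sigma> * (m (U \<omega>) * w (U \<omega>) * (1 / \<rho> \<omega>)) - \<sigma> * m (U \<omega>) \<partial>M)"
    proof (rule integral_cong_AE)
      show "AE \<omega> in M. m (U \<omega>) * ((\<sigma> * w (U \<omega>) - real_cond_exp M ?FC (\<lambda>\<omega>. \<sigma> * w (U \<omega>)) \<omega>) * (1 / \<rho> \<omega>)) =
          \<sigma> * (m (U \<omega>) * w (U \<omega>) * (1 / \<rho> \<omega>)) - \<sigma> * m (U \<omega>)"
        using FC.real_cond_exp_cmult[OF int_w, of \<sigma>] \<rho>_bound
        by eventually_elim (use w_pos in \<open>auto simp: \<rho>_def[symmetric] field_simps\<close>)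
    qed measurable
    also have "\<dots> = \<sigma> * mean_adj M C r - \<sigma> * (\<integral>\<omega>. m (U \<omega>) \<partial>M)"
    proof -
      have "integrable M (\<lambda>\<omega>. m (U \<omega>) * w (U \<omega>) * (1 / \<rho> \<omega>))"
        by (rule integrable_mult_bounded[OF wm _ inv_bound]) simp
      then have "integrable M (\<lambda>\<omega>. \<sigma> * (m (U \<omega>) * w (U \<omega>) * (1 / \<rho> \<omega>)))" by (rule integrable_mult_right)
      then show ?thesis
        unfolding adj_w by (subst Bochner_Integration.integral_diff)
          (auto simp only: int_m integrable_mult_right integral_mult_right_zero)
    qed
    finally show ?thesis by (simp add: EYa right_diff_distrib)
  qed
  show "0 \<le> \<sigma> * (mean_unadj M A Y a - mean_adj M C r)"
  proof -
    have "\<exists>\<psi> T. mono_on T (\<lambda>c. \<sigma> * \<psi> c) \<and> (AE \<omega> in M. C \<omega> \<in> T) \<and> (AE \<omega> in M. \<rho> \<omega> = \<psi> (C \<omega>))"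
      using \<sigma>
    proof
      assume "\<sigma> = 1"
      then have "mono_on S w" using w_mono by simp
      then obtain \<psi> T where "mono_on T \<psi>" "AE \<omega> in M. C \<omega> \<in> T" "AE \<omega> in M. \<rho> \<omega> = \<psi> (C \<omega>)"
        using inc(1)[unfolded stoch_increasing_def, rule_format, OF w_meas] w01 unfolding \<rho>_def by blast
      then show ?thesis using \<open>\<sigma> = 1\<close> by auto
    next
      assume \<sigma>: "\<sigma> = - 1"
      \<comment> \<open>With \<open>w\<close> decreasing, \<open>1 - w u\<close> is the increasing
        function that stays between 0 and 1.\<close>
      have "mono_on S (\<lambda>u. 1 - w u)" using w_mono \<sigma> by (auto simp: mono_on_def)
      then obtain \<psi> T where T: "mono_on T \<psi>" "AE \<omega> in M. C \<omega> \<in> T"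
        and \<psi>: "AE \<omega> in M. real_cond_exp M ?FC (\<lambda>\<omega>. 1 - w (U \<omega>)) \<omega> = \<psi> (C \<omega>)"
        using inc(1)[unfolded stoch_increasing_def, rule_format, of "\<lambda>u. 1 - w u"] w01 by auto
      have "AE \<omega> in M. \<rho> \<omega> = 1 - \<psi> (C \<omega>)"
        using \<psi> real_cond_exp_one_minus[OF M FC.sigma_finite_subalgebra_axioms int_w]
        by eventually_elim (simp add: \<rho>_def)
      then show ?thesis using T \<sigma> by (intro exI[of _ "\<lambda>c. 1 - \<psi> c"] exI[of _ T]) (auto simp: mono_on_def)
    qed
    then obtain \<psi> T where \<psi>: "mono_on T (\<lambda>c. \<sigma> * \<psi> c)" "AE \<omega> in M. C \<omega> \<in> T" "AE \<omega> in M. \<rho> \<omega> = \<psi> (C \<omega>)"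
      by blast
    \<comment> \<open>Keeps \<open>\<psi>\<close> away from zero, so that
      \<open>q / \<psi> c\<close> is decreasing in \<open>\<psi> c\<close>; the lower bound on
      \<open>\<rho>\<close> shows that \<open>T'\<close> still carries \<open>C\<close>.\<close>
    define T' where "T' = {c \<in> T. \<epsilon> \<le> \<psi> c}"
    have W_FC: "(\<lambda>\<omega>. \<sigma> * (1 - q / \<rho> \<omega>)) \<in> borel_measurable ?FC" using \<rho>_FC by simp
    have q_inv: "AE \<omega> in M. \<bar>q / \<rho> \<omega>\<bar> \<le> q / \<epsilon>"
      using \<rho>_bound by eventually_elim (use w_pos q_pos in \<open>auto intro!: divide_left_mono\<close>)
    have "0 \<le> (\<integral>\<omega>. m (U \<omega>) * (\<sigma> * (1 - q / \<rho> \<omega>)) \<partial>?N)"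
    proof (rule stoch_increasing_integral_nonneg[where C = C and T = T' and k = "\<lambda>c. \<sigma> * (1 - q / \<psi> c)",
          OF N.prob_space_axioms meas_N[OF U] meas_N[OF C] inc(2) m_meas m_mono int_Nm])
      show "mono_on T' (\<lambda>c. \<sigma> * (1 - q / \<psi> c))"
      proof (rule mono_onI)
        fix c c' assume c: "c \<in> T'" "c' \<in> T'" "c \<le> c'"
        then have "\<sigma> * \<psi> c \<le> \<sigma> * \<psi> c'" using \<psi>(1) by (auto simp: mono_on_def T'_def)
        then show "\<sigma> * (1 - q / \<psi> c) \<le> \<sigma> * (1 - q / \<psi> c')"
          using \<sigma> c w_pos(1) q_pos by (auto simp: T'_def intro!: divide_left_mono)
      qed
      show "AE \<omega> in ?N. C \<omega> \<in> T'"
        by (rule AE_N, use \<psi>(2,3) \<rho>_bound in eventually_elim) (auto simp: T'_def)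
      show "AE \<omega> in ?N. \<sigma> * (1 - q / \<rho> \<omega>) = \<sigma> * (1 - q / \<psi> (C \<omega>))"
        by (rule AE_N, use \<psi>(3) in eventually_elim) simp
      show "(\<lambda>\<omega>. \<sigma> * (1 - q / \<rho> \<omega>)) \<in> borel_measurable (sigma_gen ?N C)" using W_FC by (simp add: F_N)
      show "AE \<omega> in ?N. \<bar>\<sigma> * (1 - q / \<rho> \<omega>)\<bar> \<le> 1 + q / \<epsilon>"
      proof (rule AE_N, use q_inv in eventually_elim)
        case (elim \<omega>)
        have "\<bar>\<sigma> * (1 - q / \<rho> \<omega>)\<bar> = \<bar>1 - q / \<rho> \<omega>\<bar>" using \<sigma>_abs by (simp add: abs_mult)
        also have "\<dots> \<le> 1 + q / \<epsilon>" using elim by linarith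
        finally show ?case .
      qed
      \<comment> \<open>Mean zero in the arm: given \<open>C\<close>, \<open>I \<omega>\<close>
        averages to \<open>\<rho> \<omega>\<close>, which cancels the denominator.\<close>
      have "(\<integral>\<omega>. I \<omega> * (q / \<rho> \<omega>) \<partial>M) = q * (\<integral>\<omega>. (1 / \<rho> \<omega>) * I \<omega> \<partial>M)"
        by (subst integral_mult_right_zero[symmetric]) (simp add: mult_ac)
      also have "(\<integral>\<omega>. (1 / \<rho> \<omega>) * I \<omega> \<partial>M) = (\<integral>\<omega>. (1 / \<rho> \<omega>) * real_cond_exp M ?FC I \<omega> \<partial>M)"
        using integrable_mult_bounded[OF int_I _ inv_bound]
        by (intro FC.real_cond_exp_intg(2)[symmetric] inv_FC) (auto simp: mult.commute)
      also have "\<dots> = (\<integral>\<omega>. 1 \<partial>M)"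
      proof (rule integral_cong_AE)
        show "AE \<omega> in M. (1 / \<rho> \<omega>) * real_cond_exp M ?FC I \<omega> = 1"
          using IC \<rho>_bound by eventually_elim (use w_pos in auto)
      qed auto
      finally have "(\<integral>\<omega>. q / \<rho> \<omega> \<partial>?N) = 1" using q_pos by (simp add: integral_N prob_space)
      moreover have "integrable ?N (\<lambda>\<omega>. q / \<rho> \<omega>)"
        by (rule N.integrable_const_bound[of _ "q / \<epsilon>"]) (use AE_N[OF q_inv] in \<open>auto simp: meas_N\<close>)
      ultimately show "(\<integral>\<omega>. \<sigma> * (1 - q / \<rho> \<omega>) \<partial>?N) = 0" by (simp add: N.prob_space)
    qed
    also have "\<dots> = (\<integral>\<omega>. \<sigma> * m (U \<omega>) - \<sigma> * (m (U \<omega>) * (q / \<rho> \<omega>)) \<partial>?N)"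
      by (simp add: algebra_simps)
    also have "\<dots> = \<sigma> * mean_unadj M A Y a - \<sigma> * mean_adj M C r"
    proof -
      have "integrable ?N (\<lambda>\<omega>. m (U \<omega>) * (q / \<rho> \<omega>))"
        by (rule integrable_mult_bounded[OF int_Nm _ AE_N[OF q_inv]]) (simp add: meas_N)
      then have "integrable ?N (\<lambda>\<omega>. \<sigma> * (m (U \<omega>) * (q / \<rho> \<omega>)))" by (rule integrable_mult_right)
      then show ?thesis
        unfolding unadj adj_N by (subst Bochner_Integration.integral_diff)
          (auto simp only: int_Nm integrable_mult_right integral_mult_right_zero)
    qed
    finally show ?thesis by (simp add: right_diff_distrib)
  qed
qed

section \<open>From the two arms to their contrast\<close>

theorem theorem1:
  fixes M :: "'w measure"
    and U C A Y1 Y0 Y :: "'w \<Rightarrow> real"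
    and SU SC :: "real set"
    and p :: "real \<Rightarrow> real"
    and m r :: "real \<Rightarrow> real \<Rightarrow> real"
    and \<epsilon> :: real
    and g h :: "real \<Rightarrow> real"
    and G H :: "real set"
  assumes "prob_space M"
    and "U \<in> borel_measurable M" "C \<in> borel_measurable M" "A \<in> borel_measurable M"
    and "Y1 \<in> borel_measurable M" "Y0 \<in> borel_measurable M" "Y \<in> borel_measurable M"
    and A_binary: "\<And>\<omega>. \<omega> \<in> space M \<Longrightarrow> A \<omega> \<in> {0, 1}"
    and supports: "is_support M U SU" "is_support M C SC"
    \<comment> \<open>\<open>p u = P(A = 1 | U = u)\<close>, \<open>m a u = E(Y | A = a, U = u)\<close>, \<open>r a c = E(Y | A = a, C = c)\<close>\<close>
    and p_version: "is_cond_exp M (\<lambda>\<omega>. indicator {1} (A \<omega>)) U p"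
    and m_version: "\<And>a. a \<in> {0, 1} \<Longrightarrow> is_cond_exp (given M A a) Y U (m a)"
    and r_version: "\<And>a. a \<in> {0, 1} \<Longrightarrow> is_cond_exp (given M A a) Y C (r a)"
    and finite_expectations: "integrable M Y" "integrable M Y1" "integrable M Y0"
      "\<And>a. a \<in> {0, 1} \<Longrightarrow> integrable (distr M borel C) (r a)"
    and consistency: "AE \<omega> in M. Y \<omega> = Y1 \<omega> * A \<omega> + Y0 \<omega> * (1 - A \<omega>)"
    and positivity: "\<epsilon> > 0" "\<And>u. u \<in> SU \<Longrightarrow> \<epsilon> \<le> p u \<and> p u \<le> 1 - \<epsilon>"
    and exchangeability: "cond_indep M (\<lambda>\<omega>. (Y1 \<omega>, Y0 \<omega>)) A U"
    and outcome_mono: "\<And>a. a \<in> {0, 1} \<Longrightarrow> mono_on SU (m a)"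
    and treatment_mono: "mono_on SU p"
    and nondifferential: "cond_indep M C (\<lambda>\<omega>. (A \<omega>, Y \<omega>)) U"
    and dependence:
      "(pos_regression_dep M SU SC U C \<and>
        (\<forall>a \<in> {0, 1}. pos_regression_dep (given M A a) SU SC U C)) \<or>
       pos_likelihood_ratio_dep M SU SC C U"
    and g_mono: "mono_on G g"
      "{mean_unadj M A Y 1, mean_unadj M A Y 0, mean_adj M C (r 1), mean_adj M C (r 0),
        \<integral>\<omega>. Y1 \<omega> \<partial>M, \<integral>\<omega>. Y0 \<omega> \<partial>M} \<subseteq> G"
    and h_mono: "mono_on H h"
      "{g (mean_unadj M A Y 1) - g (mean_unadj M A Y 0),
        g (mean_adj M C (r 1)) - g (mean_adj M C (r 0)),
        g (\<integral>\<omega>. Y1 \<omega> \<partial>M) - g (\<integral>\<omega>. Y0 \<omega> \<partial>M)} \<subseteq> H"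
  shows "h (g (mean_unadj M A Y 1) - g (mean_unadj M A Y 0))
           \<ge> h (g (mean_adj M C (r 1)) - g (mean_adj M C (r 0)))
       \<and> h (g (mean_adj M C (r 1)) - g (mean_adj M C (r 0)))
           \<ge> h (g (\<integral>\<omega>. Y1 \<omega> \<partial>M) - g (\<integral>\<omega>. Y0 \<omega> \<partial>M))"
proof -
  note M = assms(1) and U = assms(2) and C = assms(3) and A = assms(4) and Y1 = assms(5) and Y0 = assms(6) and Y = assms(7)
  interpret prob_space M by fact
  note [measurable] = U C A Y1 Y0 Y
  have SU: "SU \<in> sets borel" and U_SU: "AE \<omega> in M. U \<omega> \<in> SU" and C_SC: "AE \<omega> in M. C \<omega> \<in> SC"
    using supports by (auto simp: is_support_def)
  interpret F: sigma_finite_subalgebra M "sigma_gen M U"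
    by (rule sigma_finite_subalgebra_sigma_gen) fact+
  \<comment> \<open>Clamped, because \<open>p\<close> is arbitrary outside \<open>SU\<close>.\<close>
  define w where "w a u = (if a = 1 then max 0 (min 1 (p u)) else 1 - max 0 (min 1 (p u)))" for a u :: real
  have p_meas[measurable]: "p \<in> borel_measurable borel"
    and pE: "AE \<omega> in M. p (U \<omega>) = real_cond_exp M (sigma_gen M U) (\<lambda>\<omega>. indicator {1} (A \<omega>)) \<omega>"
    using p_version by (auto simp: is_cond_exp_def)
  have w_SU: "w 1 u = p u" "w 0 u = 1 - p u" if "u \<in> SU" for u
    using positivity(2)[OF that] positivity(1) by (auto simp: w_def)
  have w_01: "0 \<le> w a u \<and> w a u \<le> 1" for a u by (auto simp: w_def)
  have w_pos: "\<epsilon> \<le> w a u" if "a \<in> {0, 1}" "u \<in> SU" for a u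
    using positivity(2)[OF that(2)] w_SU[OF that(2)] that(1) by auto
  have w_version: "is_cond_exp M (\<lambda>\<omega>. indicator {a} (A \<omega>)) U (w a)" if "a \<in> {0, 1}" for a
    unfolding is_cond_exp_def
  proof
    show "w a \<in> borel_measurable borel" unfolding w_def by simp
    have int: "integrable M (\<lambda>\<omega>. indicator {1} (A \<omega>) :: real)"
      by (rule integrable_const_bound[of _ 1]) auto
    have "AE \<omega> in M. real_cond_exp M (sigma_gen M U) (\<lambda>\<omega>. indicator {0} (A \<omega>)) \<omega> =
        real_cond_exp M (sigma_gen M U) (\<lambda>\<omega>. 1 - indicator {1} (A \<omega>)) \<omega>"
      by (rule F.real_cond_exp_cong) (use A_binary in \<open>auto split: split_indicator\<close>)
    then have "AE \<omega> in M. real_cond_exp M (sigma_gen M U) (\<lambda>\<omega>. indicator {0} (A \<omega>)) \<omega> =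
        1 - real_cond_exp M (sigma_gen M U) (\<lambda>\<omega>. indicator {1} (A \<omega>)) \<omega>"
      using real_cond_exp_one_minus[OF M F.sigma_finite_subalgebra_axioms int]
      by eventually_elim simp
    then show "AE \<omega> in M. w a (U \<omega>) = real_cond_exp M (sigma_gen M U) (\<lambda>\<omega>. indicator {a} (A \<omega>)) \<omega>"
      using pE U_SU
    proof eventually_elim
      case (elim \<omega>)
      then show ?case using that w_SU by auto
    qed
  qed
  have q0: "measure M {\<omega> \<in> space M. A \<omega> = a} \<noteq> 0" if "a \<in> {0, 1}" for a
    using measure_treatment_pos[OF M U A U_SU w_version[OF that] positivity(1) w_pos[OF that]] by simp
  have given: "prob_space (given M A a)" "U \<in> borel_measurable (given M A a)" "C \<in> borel_measurable (given M A a)"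
      "AE \<omega> in given M A a. U \<omega> \<in> SU" "AE \<omega> in given M A a. C \<omega> \<in> SC" if "a \<in> {0, 1}" for a
  proof -
    note N = M A q0[OF that]
    show "prob_space (given M A a)" by (rule prob_space_given[OF N])
    show "U \<in> borel_measurable (given M A a)" "C \<in> borel_measurable (given M A a)"
      using U C sets_given[OF N] by (simp_all cong: measurable_cong_sets)
    show "AE \<omega> in given M A a. U \<omega> \<in> SU" "AE \<omega> in given M A a. C \<omega> \<in> SC"
      using U_SU C_SC unfolding AE_given_iff[OF N] by auto
  qed
  have inc: "stoch_increasing M SU U C \<and> (\<forall>a \<in> {0, 1}. stoch_increasing (given M A a) SU U C)"
    using dependence
  proof
    assume dep: "pos_regression_dep M SU SC U C \<and> (\<forall>a \<in> {0, 1}. pos_regression_dep (given M A a) SU SC U C)"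
    show ?thesis
    proof (intro conjI ballI)
      show "stoch_increasing M SU U C"
        using dep supports by (intro pos_regression_dep_imp_stoch_increasing[OF M U C]) auto
      fix a :: real assume a: "a \<in> {0, 1}"
      show "stoch_increasing (given M A a) SU U C"
        using dep a given(4,5)[OF a] supports
        by (intro pos_regression_dep_imp_stoch_increasing[where SC = SC, OF given(1-3)[OF a]])
            (auto simp: is_support_def)
    qed
  next
    assume "pos_likelihood_ratio_dep M SU SC C U"
    then obtain f \<kappa> where \<kappa>: "is_cond_distr M C U \<kappa>"
      and f: "((\<lambda>(u, c). f u c) \<in> borel_measurable borel \<and>
          (\<forall>u \<in> SU. (\<forall>c. 0 \<le> f u c) \<and> \<kappa> u = density lborel (\<lambda>c. ennreal (f u c)))) \<or>
         (\<exists>D. countable D \<and>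
          (\<forall>u \<in> SU. measure (\<kappa> u) D = 1 \<and> (\<forall>c. f u c = measure (\<kappa> u) {c})))"
      and lr: "\<forall>c \<in> SC. \<forall>c' \<in> SC. \<forall>u \<in> SU. \<forall>u' \<in> SU. c' > c \<longrightarrow> u' > u \<longrightarrow>
             f u' c' * f u c \<ge> f u' c * f u c'"
      unfolding pos_likelihood_ratio_dep_def is_cond_density_def by blast
    show ?thesis
    proof (intro conjI ballI)
      show "stoch_increasing M SU U C"
        by (rule cond_density_imp_stoch_increasing[OF M U C SU U_SU C_SC \<kappa> f lr])
      fix a :: real assume a: "a \<in> {0, 1}"
      \<comment> \<open>The same kernel and the same \<open>f\<close> serve in each arm, so the
        likelihood ratio inequality needs no restatement there.\<close>
      have "is_cond_distr (given M A a) C U \<kappa>"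
        by (rule is_cond_distr_given[OF M U C A Y q0[OF a] w_version[OF a] w_01 nondifferential \<kappa>])
      then show "stoch_increasing (given M A a) SU U C"
        by (rule cond_density_imp_stoch_increasing[OF given(1-3)[OF a] SU given(4,5)[OF a] _ f lr])
    qed
  qed
  have X: "(\<lambda>\<omega>. (Y1 \<omega>, Y0 \<omega>)) \<in> borel_measurable M" unfolding borel_prod[symmetric] by measurable
  have fst_snd: "fst \<in> borel_measurable (borel :: (real \<times> real) measure)" "snd \<in> borel_measurable (borel :: (real \<times> real) measure)"
    unfolding borel_prod[symmetric] by measurable
  have Y_A: "AE \<omega> in M. A \<omega> = 1 \<longrightarrow> Y \<omega> = Y1 \<omega>" "AE \<omega> in M. A \<omega> = 0 \<longrightarrow> Y \<omega> = Y0 \<omega>"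
    using consistency by auto
  \<comment> \<open>The arm probability is \<open>p u\<close> for \<open>a = 1\<close> and
    \<open>1 - p u\<close> for \<open>a = 0\<close>, hence the opposite signs.\<close>
  have w_mono: "mono_on SU (\<lambda>u. 1 * w 1 u)" "mono_on SU (\<lambda>u. - 1 * w 0 u)"
    using treatment_mono by (auto simp: mono_on_def w_SU)
  have 1: "mean_adj M C (r 1) \<le> mean_unadj M A Y 1" "(\<integral>\<omega>. Y1 \<omega> \<partial>M) \<le> mean_adj M C (r 1)"
    using arm_comparison[OF M U C A Y X _ fst_snd(1) U_SU w_version w_01 positivity(1) w_pos m_version r_version
        finite_expectations(1,2,4) Y_A(1) exchangeability nondifferential outcome_mono _ w_mono(1)] inc
    by auto
  have 0: "mean_unadj M A Y 0 \<le> mean_adj M C (r 0)" "mean_adj M C (r 0) \<le> (\<integral>\<omega>. Y0 \<omega> \<partial>M)"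
    using arm_comparison[OF M U C A Y X _ fst_snd(2) U_SU w_version w_01 positivity(1) w_pos m_version r_version
        finite_expectations(1,3,4) Y_A(2) exchangeability nondifferential outcome_mono _ w_mono(2)] inc
    by auto
  have g_le: "g x \<le> g y" if "x \<in> G" "y \<in> G" "x \<le> y" for x y
    using g_mono(1) that by (rule mono_onD)
  have h_le: "h x \<le> h y" if "x \<in> H" "y \<in> H" "x \<le> y" for x y
    using h_mono(1) that by (rule mono_onD)
  \<comment> \<open>From unadjusted to adjusted to causal, the mean of arm 1 falls and that of arm 0
    rises. So the difference after applying \<open>g\<close> falls, and \<open>h\<close> preserves
    this.\<close>
  show ?thesis
    by (intro conjI h_le diff_mono g_le) (use 1 0 g_mono(2) h_mono(2) in auto)
qed

end
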